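(* Let $\delta\in\mathbb C^\times$ and let $\mathcal M_\delta$ be the binary quadratic operad over $\mathbb C$ governing $\delta$-mock-Novikov algebras. Its quadratic dual $\mathcal M_\delta^!$ is generated by a binary operation $\star$ (with no symmetry) subject to the relations $$x\star(y\star z)+y\star(x\star z)=0,$$ $$(x\star y)\star z+(x\star z)\star y+\delta\,x\star(y\star z)+\delta\,x\star(z\star y)=0.$$ Moreover, $\mathcal M_\delta^!\cong\mathcal M_\delta$ as operads; that is, the operad of $\delta$-mock-Novikov algebras is quadratically self-dual.
   Context: The ground field is $\mathbb C$. Let $E$ be the $S$-module concentrated in arity two with $E(2)=\mathbb C[S_2]$ the regular $S_2$-module, with basis represented by $x\circ y$ and $y\circ x$. Let $\mathcal F(E)$ be the free symmetric operad generated by $E$. The space $\mathcal F(E)(3)$ has dimension 12 with basis, for $\sigma\in S_3$, $$L_\sigma=(x_{\sigma(1)}\circ x_{\sigma(2)})\circ x_{\sigma(3)},\qquad T_\sigma=x_{\sigma(1)}\circ(x_{\sigma(2)}\circ x_{\sigma(3)}).$$ Let $\mathcal R_\delta\subseteq\mathcal F(E)(3)$ be the $S_3$-submodule generated by $$r_{1,\delta}(x,y,z)=\delta(x\circ y)\circ z+\delta(y\circ x)\circ z+x\circ(y\circ z)+y\circ(x\circ z),$$ $$r_2(x,y,z)=(x\circ y)\circ z+(x\circ z)\circ y.$$ Then $\mathcal M_\delta=\mathcal F(E)/(\mathcal R_\delta)$, where $(\mathcal R_\delta)$ is the operadic ideal generated by $\mathcal R_\delta$. Quadratic dual: let $E^\vee=E^*\otimes\operatorname{sgn}_2$,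 which is again (isomorphic to) the regular $S_2$-module in arity two; its binary generator is written $\star$. Let $L_\sigma^\vee=(x_{\sigma(1)}\star x_{\sigma(2)})\star x_{\sigma(3)}$ and $T_\sigma^\vee=x_{\sigma(1)}\star(x_{\sigma(2)}\star x_{\sigma(3)})$ be the corresponding basis of $\mathcal F(E^\vee)(3)$. The (Ginzburg–Kapranov) pairing between $\mathcal F(E^\vee)(3)$ and $\mathcal F(E)(3)$ is given by $$\langle L_\sigma^\vee,L_\tau\rangle=\operatorname{sgn}(\sigma)\delta_{\sigma,\tau},\quad \langle T_\sigma^\vee,T_\tau\rangle=-\operatorname{sgn}(\sigma)\delta_{\sigma,\tau},\quad \langle L_\sigma^\vee,T_\tau\rangle=\langle T_\sigma^\vee,L_\tau\rangle=0,$$ where $\delta_{\sigma,\tau}$ is the Kronecker delta. Put $\mathcal R_\delta^\perp=\{f\in\mathcal F(E^\vee)(3)\mid\langle f,r\rangle=0\ \text{for all } r\in\mathcal R_\delta\}$ and $\mathcal M_\delta^!=\mathcal F(E^\vee)/(\mathcal R_\delta^\perp)$, where $(\mathcal R_\delta^\perp)$ is the operadic ideal generated by $\mathcal R_\delta^\perp$. *)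

theory Defs
  imports
    "HOL-Algebra.Module"
    "HOL-Algebra.AbelCoset"
    "HOL-Algebra.Algebraic_Closure_Type"
    "HOL-Library.Poly_Mapping"
    "HOL-Combinatorics.Permutations"
begin

section \<open>Symmetric operads over the complex numbers\<close>

abbreviation complex_ring :: "complex ring" where
  "complex_ring \<equiv> ring_of_type_algebra"

text \<open>
  \<open>part_comp P m i n x y\<close> is the partial composition of \<open>x\<close> (arity \<open>m\<close>) and \<open>y\<close> (arity \<open>n\<close>) at
  the input \<open>i\<close>; inputs are numbered from 1. \<open>sym_act P n s x\<close> is the left action of the
  permutation \<open>s\<close> of \<open>{1..n}\<close> that renames the input \<open>k\<close> of \<open>x\<close> to \<open>s k\<close>, so in the usual notation
  for the right action it is \<open>x\<close> acted upon by the inverse of \<open>s\<close>.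
\<close>
record 'a operad =
  arity_space :: "nat \<Rightarrow> (complex, 'a) module"
  sym_act :: "nat \<Rightarrow> (nat \<Rightarrow> nat) \<Rightarrow> 'a \<Rightarrow> 'a"
  part_comp :: "nat \<Rightarrow> nat \<Rightarrow> nat \<Rightarrow> 'a \<Rightarrow> 'a \<Rightarrow> 'a"
  op_unit :: 'a

abbreviation operad_carrier :: "('a, 'c) operad_scheme \<Rightarrow> nat \<Rightarrow> 'a set" where
  "operad_carrier P n \<equiv> carrier (arity_space P n)"

text \<open>
  When an operation of arity \<open>n\<close> is inserted at the input \<open>i\<close>, every other input \<open>k\<close> becomes the
  input \<open>shift_input i n k\<close>, and the input \<open>j\<close> of the inserted operation becomes \<open>i + j - 1\<close>.
\<close>
definition shift_input :: "nat \<Rightarrow> nat \<Rightarrow> nat \<Rightarrow> nat" where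
  "shift_input i n k = (if k < i then k else k + n - 1)"

text \<open>
  The permutation of \<open>{1..m+n-1}\<close> that \<open>s\<close> (on \<open>{1..m}\<close>) and \<open>t\<close> (on \<open>{1..n}\<close>) induce on the inputs
  of a partial composition at \<open>i\<close>: it carries the composition at \<open>i\<close> to the one at \<open>s i\<close>.
\<close>
definition block_perm :: "nat \<Rightarrow> nat \<Rightarrow> nat \<Rightarrow> (nat \<Rightarrow> nat) \<Rightarrow> (nat \<Rightarrow> nat) \<Rightarrow> nat \<Rightarrow> nat" where
  "block_perm m i n s t k =
     (if k \<notin> {1..m + n - 1} then k
      else if k < i then shift_input (s i) n (s k)
      else if k < i + n then s i + t (k + 1 - i) - 1
      else shift_input (s i) n (s (k + 1 - n)))"

locale symmetric_operad =
  fixes P :: "('a, 'c) operad_scheme"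
  assumes space: "module complex_ring (arity_space P n)"
    and act_closed: "\<lbrakk>s permutes {1..n}; x \<in> operad_carrier P n\<rbrakk>
      \<Longrightarrow> sym_act P n s x \<in> operad_carrier P n"
    and act_add: "\<lbrakk>s permutes {1..n}; x \<in> operad_carrier P n; y \<in> operad_carrier P n\<rbrakk>
      \<Longrightarrow> sym_act P n s (x \<oplus>\<^bsub>arity_space P n\<^esub> y)
          = sym_act P n s x \<oplus>\<^bsub>arity_space P n\<^esub> sym_act P n s y"
    and act_smult: "\<lbrakk>s permutes {1..n}; x \<in> operad_carrier P n\<rbrakk>
      \<Longrightarrow> sym_act P n s (c \<odot>\<^bsub>arity_space P n\<^esub> x) = c \<odot>\<^bsub>arity_space P n\<^esub> sym_act P n s x"
    and act_id: "x \<in> operad_carrier P n \<Longrightarrow> sym_act P n id x = x"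
    and act_comp: "\<lbrakk>s permutes {1..n}; t permutes {1..n}; x \<in> operad_carrier P n\<rbrakk>
      \<Longrightarrow> sym_act P n (s \<circ> t) x = sym_act P n s (sym_act P n t x)"
    and unit_closed: "op_unit P \<in> operad_carrier P 1"
    and comp_closed: "\<lbrakk>i \<in> {1..m}; x \<in> operad_carrier P m; y \<in> operad_carrier P n\<rbrakk>
      \<Longrightarrow> part_comp P m i n x y \<in> operad_carrier P (m + n - 1)"
    and comp_add_left: "\<lbrakk>i \<in> {1..m}; x \<in> operad_carrier P m; x' \<in> operad_carrier P m;
        y \<in> operad_carrier P n\<rbrakk>
      \<Longrightarrow> part_comp P m i n (x \<oplus>\<^bsub>arity_space P m\<^esub> x') y
          = part_comp P m i n x y \<oplus>\<^bsub>arity_space P (m + n - 1)\<^esub> part_comp P m i n x' y"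
    and comp_add_right: "\<lbrakk>i \<in> {1..m}; x \<in> operad_carrier P m; y \<in> operad_carrier P n;
        y' \<in> operad_carrier P n\<rbrakk>
      \<Longrightarrow> part_comp P m i n x (y \<oplus>\<^bsub>arity_space P n\<^esub> y')
          = part_comp P m i n x y \<oplus>\<^bsub>arity_space P (m + n - 1)\<^esub> part_comp P m i n x y'"
    and comp_smult_left: "\<lbrakk>i \<in> {1..m}; x \<in> operad_carrier P m; y \<in> operad_carrier P n\<rbrakk>
      \<Longrightarrow> part_comp P m i n (c \<odot>\<^bsub>arity_space P m\<^esub> x) y
          = c \<odot>\<^bsub>arity_space P (m + n - 1)\<^esub> part_comp P m i n x y"
    and comp_smult_right: "\<lbrakk>i \<in> {1..m}; x \<in> operad_carrier P m; y \<in> operad_carrier P n\<rbrakk>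
      \<Longrightarrow> part_comp P m i n x (c \<odot>\<^bsub>arity_space P n\<^esub> y)
          = c \<odot>\<^bsub>arity_space P (m + n - 1)\<^esub> part_comp P m i n x y"
    and unit_left: "x \<in> operad_carrier P n \<Longrightarrow> part_comp P 1 1 n (op_unit P) x = x"
    and unit_right: "\<lbrakk>i \<in> {1..n}; x \<in> operad_carrier P n\<rbrakk>
      \<Longrightarrow> part_comp P n i 1 x (op_unit P) = x"
    and assoc_sequential: "\<lbrakk>i \<in> {1..l}; j \<in> {1..m}; x \<in> operad_carrier P l;
        y \<in> operad_carrier P m; z \<in> operad_carrier P n\<rbrakk>
      \<Longrightarrow> part_comp P (l + m - 1) (i + j - 1) n (part_comp P l i m x y) z
          = part_comp P l i (m + n - 1) x (part_comp P m j n y z)"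
    and assoc_parallel: "\<lbrakk>i \<in> {1..l}; k \<in> {1..l}; i < k; x \<in> operad_carrier P l;
        y \<in> operad_carrier P m; z \<in> operad_carrier P n\<rbrakk>
      \<Longrightarrow> part_comp P (l + m - 1) (k + m - 1) n (part_comp P l i m x y) z
          = part_comp P (l + n - 1) i m (part_comp P l k n x z) y"
    and equivariant: "\<lbrakk>i \<in> {1..m}; s permutes {1..m}; t permutes {1..n};
        x \<in> operad_carrier P m; y \<in> operad_carrier P n\<rbrakk>
      \<Longrightarrow> part_comp P m (s i) n (sym_act P m s x) (sym_act P n t y)
          = sym_act P (m + n - 1) (block_perm m i n s t) (part_comp P m i n x y)"

definition operad_hom ::
    "('a, 'c) operad_scheme \<Rightarrow> ('b, 'd) operad_scheme \<Rightarrow> (nat \<Rightarrow> 'a \<Rightarrow> 'b) \<Rightarrow> bool" where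
  "operad_hom P Q \<phi> \<longleftrightarrow>
     (\<forall>n. \<forall>x \<in> operad_carrier P n. \<phi> n x \<in> operad_carrier Q n) \<and>
     (\<forall>n. \<forall>x \<in> operad_carrier P n. \<forall>y \<in> operad_carrier P n.
        \<phi> n (x \<oplus>\<^bsub>arity_space P n\<^esub> y) = \<phi> n x \<oplus>\<^bsub>arity_space Q n\<^esub> \<phi> n y) \<and>
     (\<forall>n c. \<forall>x \<in> operad_carrier P n.
        \<phi> n (c \<odot>\<^bsub>arity_space P n\<^esub> x) = c \<odot>\<^bsub>arity_space Q n\<^esub> \<phi> n x) \<and>
     (\<forall>n s. \<forall>x \<in> operad_carrier P n. s permutes {1..n} \<longrightarrow>
        \<phi> n (sym_act P n s x) = sym_act Q n s (\<phi> n x)) \<and>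
     \<phi> 1 (op_unit P) = op_unit Q \<and>
     (\<forall>m n. \<forall>i \<in> {1..m}. \<forall>x \<in> operad_carrier P m. \<forall>y \<in> operad_carrier P n.
        \<phi> (m + n - 1) (part_comp P m i n x y) = part_comp Q m i n (\<phi> m x) (\<phi> n y))"

definition operads_isomorphic :: "('a, 'c) operad_scheme \<Rightarrow> ('b, 'd) operad_scheme \<Rightarrow> bool" where
  "operads_isomorphic P Q \<longleftrightarrow> symmetric_operad P \<and> symmetric_operad Q \<and>
     (\<exists>\<phi>. operad_hom P Q \<phi> \<and> (\<forall>n. bij_betw (\<phi> n) (operad_carrier P n) (operad_carrier Q n)))"

section \<open>Submodules, ideals, quotients\<close>

definition sym_submodule :: "('a, 'c) operad_scheme \<Rightarrow> nat \<Rightarrow> 'a set \<Rightarrow> bool" where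
  "sym_submodule P n N \<longleftrightarrow> submodule N complex_ring (arity_space P n) \<and>
     (\<forall>s. s permutes {1..n} \<longrightarrow> (\<forall>x \<in> N. sym_act P n s x \<in> N))"

definition sym_submodule_gen :: "('a, 'c) operad_scheme \<Rightarrow> nat \<Rightarrow> 'a set \<Rightarrow> 'a set" where
  "sym_submodule_gen P n G = \<Inter>{N. sym_submodule P n N \<and> G \<subseteq> N}"

definition operad_ideal :: "('a, 'c) operad_scheme \<Rightarrow> (nat \<Rightarrow> 'a set) \<Rightarrow> bool" where
  "operad_ideal P I \<longleftrightarrow>
     (\<forall>n. sym_submodule P n (I n)) \<and>
     (\<forall>m n. \<forall>i \<in> {1..m}. \<forall>x \<in> operad_carrier P m. \<forall>y \<in> operad_carrier P n.
        x \<in> I m \<or> y \<in> I n \<longrightarrow> part_comp P m i n x y \<in> I (m + n - 1))"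

definition operad_ideal_gen :: "('a, 'c) operad_scheme \<Rightarrow> nat \<Rightarrow> 'a set \<Rightarrow> nat \<Rightarrow> 'a set" where
  "operad_ideal_gen P k G n = \<Inter>{I n |I. operad_ideal P I \<and> G \<subseteq> I k}"

text \<open>
  The elements of the quotient are cosets. Each operation is the union of the cosets obtained from
  all choices of representatives, which is a single coset when \<open>I\<close> is an ideal. The fields
  \<open>mult\<close> and \<open>one\<close> of the \<open>module\<close> record play no role in a module.
\<close>
definition quotient_operad ::
    "('a, 'c) operad_scheme \<Rightarrow> (nat \<Rightarrow> 'a set) \<Rightarrow> 'a set operad" where
  "quotient_operad P I =
     \<lparr> arity_space = (\<lambda>n.
         \<lparr> carrier = a_rcosets\<^bsub>arity_space P n\<^esub> (I n),
           monoid.mult = undefined, one = undefined,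
           zero = I n,
           add = (\<lambda>A B. A <+>\<^bsub>arity_space P n\<^esub> B),
           module.smult = (\<lambda>c A. \<Union>x\<in>A. I n +>\<^bsub>arity_space P n\<^esub> (c \<odot>\<^bsub>arity_space P n\<^esub> x)) \<rparr>),
       sym_act = (\<lambda>n s A. \<Union>x\<in>A. I n +>\<^bsub>arity_space P n\<^esub> sym_act P n s x),
       part_comp = (\<lambda>m i n A B. \<Union>x\<in>A. \<Union>y\<in>B.
         I (m + n - 1) +>\<^bsub>arity_space P (m + n - 1)\<^esub> part_comp P m i n x y),
       op_unit = I 1 +>\<^bsub>arity_space P 1\<^esub> op_unit P \<rparr>"

section \<open>The free operad on the regular module in arity two\<close>

text \<open>
  The tree construction of the free symmetric operad generated by one binary operation without
  symmetry: arity \<open>n\<close> has as basis the planar binary trees whose leaves are labelled bijectively by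
  \<open>{1..n}\<close>.
\<close>
datatype monomial = Var nat | Prod monomial monomial

primrec variables :: "monomial \<Rightarrow> nat list" where
  "variables (Var k) = [k]"
| "variables (Prod u v) = variables u @ variables v"

primrec substitute :: "(nat \<Rightarrow> monomial) \<Rightarrow> monomial \<Rightarrow> monomial" where
  "substitute f (Var k) = f k"
| "substitute f (Prod u v) = Prod (substitute f u) (substitute f v)"

definition rename :: "(nat \<Rightarrow> nat) \<Rightarrow> monomial \<Rightarrow> monomial" where
  "rename s = substitute (\<lambda>k. Var (s k))"

definition multilinear_monomials :: "nat \<Rightarrow> monomial set" where
  "multilinear_monomials n = {t. distinct (variables t) \<and> set (variables t) = {1..n}}"

definition graft :: "nat \<Rightarrow> nat \<Rightarrow> monomial \<Rightarrow> monomial \<Rightarrow> monomial" where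
  "graft i n u v =
     substitute (\<lambda>k. if k = i then rename (\<lambda>j. i + j - 1) v else Var (shift_input i n k)) u"

type_synonym tree_poly = "monomial \<Rightarrow>\<^sub>0 complex"

definition free_operad :: "tree_poly operad" where
  "free_operad =
     \<lparr> arity_space = (\<lambda>n.
         \<lparr> carrier = {p. Poly_Mapping.keys p \<subseteq> multilinear_monomials n},
           monoid.mult = undefined, one = undefined,
           zero = 0,
           add = (+),
           module.smult = (\<lambda>c. Poly_Mapping.map (\<lambda>a. c * a)) \<rparr>),
       sym_act = (\<lambda>n s p. \<Sum>u \<in> Poly_Mapping.keys p.
         Poly_Mapping.single (rename s u) (Poly_Mapping.lookup p u)),
       part_comp = (\<lambda>m i n p q. \<Sum>u \<in> Poly_Mapping.keys p. \<Sum>v \<in> Poly_Mapping.keys q.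
         Poly_Mapping.single (graft i n u v) (Poly_Mapping.lookup p u * Poly_Mapping.lookup q v)),
       op_unit = Poly_Mapping.single (Var 1) 1 \<rparr>"

definition quadratic_operad :: "tree_poly set \<Rightarrow> tree_poly set operad" where
  "quadratic_operad R = quotient_operad free_operad (operad_ideal_gen free_operad 3 R)"

definition left_monomial :: "nat \<Rightarrow> nat \<Rightarrow> nat \<Rightarrow> monomial" where
  "left_monomial a b c = Prod (Prod (Var a) (Var b)) (Var c)"

definition right_monomial :: "nat \<Rightarrow> nat \<Rightarrow> nat \<Rightarrow> monomial" where
  "right_monomial a b c = Prod (Var a) (Prod (Var b) (Var c))"

section \<open>Quadratic duality\<close>

text \<open>
  The module dual to the regular module, twisted by the sign, is identified with the regular module,
  so the free operad on it is again \<open>free_operad\<close>, whose generator is then the dual product.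
  The first argument of the pairing lies in this second copy.
\<close>
definition gk_pairing :: "tree_poly \<Rightarrow> tree_poly \<Rightarrow> complex" where
  "gk_pairing f r = (\<Sum>s | s permutes {1..3::nat}. of_int (sign s) *
     (Poly_Mapping.lookup f (left_monomial (s 1) (s 2) (s 3)) *
        Poly_Mapping.lookup r (left_monomial (s 1) (s 2) (s 3)) -
      Poly_Mapping.lookup f (right_monomial (s 1) (s 2) (s 3)) *
        Poly_Mapping.lookup r (right_monomial (s 1) (s 2) (s 3))))"

definition gk_annihilator :: "tree_poly set \<Rightarrow> tree_poly set" where
  "gk_annihilator R = {f \<in> operad_carrier free_operad 3. \<forall>r \<in> R. gk_pairing f r = 0}"

section \<open>Mock-Novikov operads\<close>

definition mock_novikov_rel1 :: "complex \<Rightarrow> tree_poly" where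
  "mock_novikov_rel1 \<delta> =
     Poly_Mapping.single (left_monomial 1 2 3) \<delta> + Poly_Mapping.single (left_monomial 2 1 3) \<delta> +
     Poly_Mapping.single (right_monomial 1 2 3) 1 + Poly_Mapping.single (right_monomial 2 1 3) 1"

definition mock_novikov_rel2 :: tree_poly where
  "mock_novikov_rel2 =
     Poly_Mapping.single (left_monomial 1 2 3) 1 + Poly_Mapping.single (left_monomial 1 3 2) 1"

definition mock_novikov_relations :: "complex \<Rightarrow> tree_poly set" where
  "mock_novikov_relations \<delta> =
     sym_submodule_gen free_operad 3 {mock_novikov_rel1 \<delta>, mock_novikov_rel2}"

definition mock_novikov_operad :: "complex \<Rightarrow> tree_poly set operad" where
  "mock_novikov_operad \<delta> = quadratic_operad (mock_novikov_relations \<delta>)"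

definition mock_novikov_dual :: "complex \<Rightarrow> tree_poly set operad" where
  "mock_novikov_dual \<delta> = quadratic_operad (gk_annihilator (mock_novikov_relations \<delta>))"

definition dual_rel1 :: tree_poly where
  "dual_rel1 =
     Poly_Mapping.single (right_monomial 1 2 3) 1 + Poly_Mapping.single (right_monomial 2 1 3) 1"

definition dual_rel2 :: "complex \<Rightarrow> tree_poly" where
  "dual_rel2 \<delta> =
     Poly_Mapping.single (left_monomial 1 2 3) 1 + Poly_Mapping.single (left_monomial 1 3 2) 1 +
     Poly_Mapping.single (right_monomial 1 2 3) \<delta> + Poly_Mapping.single (right_monomial 1 3 2) \<delta>"

end

theory Submission
  imports Defs
begin

text \<open>
  Reversing all planar trees, i.e. passing to the opposite product, is an involutive automorphism of
  the free operad. It exchanges the two relations of the dual with the second and the first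
  mock-Novikov relation, up to renaming the variables by the transposition of 1 and 3, so it
  identifies the ideals that they generate and hence the quotients. That the two dual relations span
  the annihilator as a module over the symmetric group is linear algebra with the 12 coefficients.
\<close>

section \<open>Grafting of monomials\<close>

text \<open>Two features of the pairing fix the shape of the dual. Exchanging two labels changes
  \<open>sign\<close>, so orthogonality to a sum of two trees that differ by such an exchange forces
  equal coefficients, and the dual relations carry plus signs again. The opposite sign on right
  combs turns the \<delta> on the left combs of \<open>mock_novikov_rel1\<close> into the \<delta>
  on the right combs of \<open>dual_rel2\<close>. Each pair thus has one relation with combs of a
  single kind, left for the mock-Novikov pair and right for the dual pair, which suggests reversing
  the product. No dimension is counted: the dual relations annihilate, and every invariant submodule
  containing them contains the annihilator. Most of the work comes from
  \<open>operads_isomorphic\<close>, which also asks that both quotients satisfy the operad axioms.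
  These are identities of labelled trees, extended multilinearly and then carried over to cosets; as
  the coset operations are unions over representatives, they must first be shown to be well
  defined.\<close>

lemma substitute_cong:
  "(\<And>k. k \<in> set (variables u) \<Longrightarrow> f k = g k) \<Longrightarrow> substitute f u = substitute g u"
  by (induction u) auto

lemma substitute_substitute: "substitute f (substitute g u) = substitute (\<lambda>k. substitute f (g k)) u"
  by (induction u) auto

lemma substitute_Var: "substitute Var u = u"
  by (induction u) auto

lemma variables_substitute:
  "variables (substitute f u) = concat (map (\<lambda>k. variables (f k)) (variables u))"
  by (induction u) auto

lemma rename_simps [simp]:
  "rename s (Var k) = Var (s k)"
  "rename s (Prod u v) = Prod (rename s u) (rename s v)"
  by (simp_all add: rename_def)

lemma variables_rename: "variables (rename s u) = map s (variables u)"
  by (induction u) auto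

lemma rename_id: "rename id u = u"
  by (simp add: rename_def substitute_Var)

lemma rename_rename: "rename s (rename t u) = rename (s \<circ> t) u"
  by (induction u) auto

lemma rename_cong: "(\<And>k. k \<in> set (variables u) \<Longrightarrow> s k = t k) \<Longrightarrow> rename s u = rename t u"
  unfolding rename_def by (rule substitute_cong) auto

lemma rename_substitute: "rename s (substitute f u) = substitute (\<lambda>k. rename s (f k)) u"
  by (induction u) auto

lemma substitute_rename: "substitute f (rename s u) = substitute (\<lambda>k. f (s k)) u"
  by (induction u) auto

lemma variables_nonempty: "variables u \<noteq> []"
  by (induction u) auto

text \<open>A tree has at least one leaf, so there are no trees of arity zero. This is what controls
  the truncated subtraction in \<open>m + n - 1\<close> and in the renumbering of inputs.\<close>

lemma multilinear_monomials_pos: "u \<in> multilinear_monomials n \<Longrightarrow> 1 \<le> n"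
  using variables_nonempty[of u] by (cases n) (auto simp: multilinear_monomials_def)

lemma Var_multilinear: "Var 1 \<in> multilinear_monomials 1"
  by (auto simp: multilinear_monomials_def)

lemma rename_multilinear:
  assumes "s permutes {1..n}" "u \<in> multilinear_monomials n"
  shows "rename s u \<in> multilinear_monomials n"
  using assms permutes_inj_on[OF assms(1)] permutes_image[OF assms(1)]
  by (auto simp: multilinear_monomials_def variables_rename distinct_map intro: inj_on_subset)

text \<open>Distinctness of the leaves of a grafting follows by counting, since all of \<open>{1..m + n - 1}\<close>
  occurs.\<close>
lemma graft_multilinear:
  assumes i: "i \<in> {1..m}" and u: "u \<in> multilinear_monomials m" and v: "v \<in> multilinear_monomials n"
  shows "graft i n u v \<in> multilinear_monomials (m + n - 1)"
proof -
  have n: "1 \<le> n" using multilinear_monomials_pos[OF v] .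
  have su: "set (variables u) = {1..m}" and du: "distinct (variables u)"
    and sv: "set (variables v) = {1..n}" and dv: "distinct (variables v)"
    using u v by (auto simp: multilinear_monomials_def)
  have lv: "length (variables v) = n"
    using distinct_card[OF dv] sv by simp
  define f where "f = (\<lambda>k. if k = i then rename (\<lambda>j. i + j - 1) v else Var (shift_input i n k))"
  have g: "graft i n u v = substitute f u"
    by (simp add: graft_def f_def)
  have "set (variables (graft i n u v)) = (\<Union>k\<in>{1..m}. set (variables (f k)))"
    by (simp add: g variables_substitute su)
  also have "\<dots> = {1..m + n - 1}"
  proof (intro equalityI subsetI)
    fix l assume "l \<in> (\<Union>k\<in>{1..m}. set (variables (f k)))"
    then show "l \<in> {1..m + n - 1}"
      using i n by (auto simp: f_def variables_rename sv shift_input_def split: if_splits)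
  next
    fix l assume l: "l \<in> {1..m + n - 1}"
    \<comment> \<open>Labels before the slot, in the grafted block and after it come from the leaves
      \<open>l\<close>, \<open>i\<close> and \<open>l + 1 - n\<close> of \<open>u\<close>
      respectively.\<close>
    consider "l < i" | "i \<le> l" "l < i + n" | "i + n \<le> l" by linarith
    then show "l \<in> (\<Union>k\<in>{1..m}. set (variables (f k)))"
    proof cases
      case 1
      then show ?thesis using i l by (intro UN_I[of l]) (auto simp: f_def shift_input_def)
    next
      case 2
      then have "l \<in> (\<lambda>j. i + j - 1) ` {1..n}"
        by (intro image_eqI[of _ _ "l + 1 - i"]) auto
      then show ?thesis using i by (intro UN_I[of i]) (simp_all add: f_def variables_rename sv)
    next
      case 3
      then show ?thesis using i l n
        by (intro UN_I[of "l + 1 - n"]) (auto simp: f_def shift_input_def)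
    qed
  qed
  finally have set: "set (variables (graft i n u v)) = {1..m + n - 1}" .
  have "length (variables (graft i n u v)) = (\<Sum>k\<leftarrow>variables u. length (variables (f k)))"
    by (simp add: g variables_substitute length_concat comp_def)
  also have "\<dots> = (\<Sum>k\<in>{1..m}. length (variables (f k)))"
    using sum_list_distinct_conv_sum_set[OF du] su by metis
  also have "\<dots> = length (variables (f i)) + (\<Sum>k\<in>{1..m} - {i}. length (variables (f k)))"
    using i by (intro sum.remove) auto
  also have "(\<Sum>k\<in>{1..m} - {i}. length (variables (f k))) = (\<Sum>k\<in>{1..m} - {i}. 1)"
    by (intro sum.cong) (auto simp: f_def)
  also have "\<dots> = m - 1"
    using i by simp
  also have "length (variables (f i)) = n"
    by (simp add: f_def variables_rename lv)
  finally have "length (variables (graft i n u v)) = m + n - 1"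
    using i by simp
  then have "distinct (variables (graft i n u v))"
    by (intro card_distinct) (simp add: set)
  with set show ?thesis by (simp add: multilinear_monomials_def)
qed

lemma graft_Var_left: "graft 1 n (Var 1) v = v"
  by (simp add: graft_def rename_def substitute_Var)

lemma graft_Var_right: "graft i 1 u (Var 1) = u"
proof -
  have "(\<lambda>k. if k = i then rename (\<lambda>j. i + j - 1) (Var 1) else Var (shift_input i 1 k)) = Var"
    by (auto simp: shift_input_def)
  then show ?thesis by (simp only: graft_def substitute_Var)
qed

text \<open>Both sides are substitutions into \<open>u\<close>, so they are compared leaf by leaf.
  Away from the leaf \<open>i\<close> only shifts are involved; at \<open>i\<close> the claim is
  that grafting \<open>w\<close> into \<open>v\<close> commutes with moving \<open>v\<close> to its
  block.\<close>

lemma graft_assoc_sequential: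
  assumes "i \<in> {1..l}" "j \<in> {1..m}" "u \<in> multilinear_monomials l" "v \<in> multilinear_monomials m"
    "w \<in> multilinear_monomials n"
  shows "graft (i + j - 1) n (graft i m u v) w = graft i (m + n - 1) u (graft j n v w)"
proof -
  have mn: "1 \<le> m" "1 \<le> n" using assms multilinear_monomials_pos by blast+
  show ?thesis
    unfolding graft_def substitute_substitute
  proof (rule substitute_cong, goal_cases)
    case (1 k)
    show ?case
    proof (cases "k = i")
      case True
      have "substitute (\<lambda>h. if h = i + j - 1 then rename (\<lambda>h. i + j - 1 + h - 1) w
          else Var (shift_input (i + j - 1) n h)) (rename (\<lambda>j. i + j - 1) v)
        = rename (\<lambda>j. i + j - 1) (substitute (\<lambda>h. if h = j then rename (\<lambda>h. j + h - 1) w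
          else Var (shift_input j n h)) v)"
        unfolding substitute_rename rename_substitute
      proof (rule substitute_cong, goal_cases)
        case (1 h)
        then have "1 \<le> h" using assms by (auto simp: multilinear_monomials_def)
        with assms mn show ?case
          by (auto simp: rename_rename shift_input_def multilinear_monomials_def intro!: rename_cong)
      qed
      with True show ?thesis by simp
    next
      case False
      with 1 assms mn show ?thesis by (auto simp: shift_input_def)
    qed
  qed
qed

text \<open>Again a comparison on the leaves of \<open>u\<close>. The slots are disjoint, so each
  grafting can at most shift the block inserted by the other.\<close>

lemma graft_assoc_parallel:
  assumes "i \<in> {1..l}" "k \<in> {1..l}" "i < k" "u \<in> multilinear_monomials l"
    "v \<in> multilinear_monomials m" "w \<in> multilinear_monomials n"
  shows "graft (k + m - 1) n (graft i m u v) w = graft i m (graft k n u w) v"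
proof -
  have mn: "1 \<le> m" "1 \<le> n" using assms multilinear_monomials_pos by blast+
  show ?thesis
    unfolding graft_def substitute_substitute
  proof (rule substitute_cong, goal_cases)
    case (1 h)
    consider "h = i" | "h = k" | "h \<noteq> i" "h \<noteq> k" by blast
    then show ?case
    proof cases
      case 1
      \<comment> \<open>The block of \<open>v\<close> ends at \<open>i + m - 1\<close>, which lies
        before the slot \<open>k + m - 1\<close>, so grafting \<open>w\<close> leaves it
        fixed.\<close>
      have "substitute (\<lambda>h. if h = k + m - 1 then rename (\<lambda>j. k + m - 1 + j - 1) w
          else Var (shift_input (k + m - 1) n h)) (rename (\<lambda>j. i + j - 1) v)
        = rename (\<lambda>j. i + j - 1) v"
        unfolding substitute_rename unfolding rename_def
        using assms mn by (intro substitute_cong) (auto simp: shift_input_def multilinear_monomials_def)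
      with 1 assms mn show ?thesis by (simp add: shift_input_def)
    next
      case 2
      \<comment> \<open>The block of \<open>w\<close> starts at \<open>k\<close>, beyond
        \<open>i\<close>, so grafting \<open>v\<close> shifts all of it by
        \<open>m - 1\<close>.\<close>
      have "substitute (\<lambda>h. if h = i then rename (\<lambda>j. i + j - 1) v
          else Var (shift_input i m h)) (rename (\<lambda>j. k + j - 1) w)
        = rename (\<lambda>j. k + m - 1 + j - 1) w"
        unfolding substitute_rename unfolding rename_def
        using assms mn by (intro substitute_cong) (auto simp: shift_input_def multilinear_monomials_def)
      with 2 assms mn show ?thesis by (simp add: shift_input_def)
    next
      case 3
      with 1 assms mn show ?thesis by (auto simp: shift_input_def)
    qed
  qed
qed

text \<open>On the block at \<open>i\<close>, \<open>block_perm\<close> is \<open>t\<close> moved to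
  the slot \<open>s i\<close>; elsewhere it is \<open>s\<close> followed by the shift. Injectivity
  of \<open>s\<close> keeps the other leaves away from that slot.\<close>

lemma graft_equivariant:
  assumes i: "i \<in> {1..m}" and s: "s permutes {1..m}" and t: "t permutes {1..n}"
    and u: "u \<in> multilinear_monomials m" and v: "v \<in> multilinear_monomials n"
  shows "graft (s i) n (rename s u) (rename t v) = rename (block_perm m i n s t) (graft i n u v)"
  unfolding graft_def substitute_rename rename_substitute
proof (rule substitute_cong, goal_cases)
  case (1 k)
  then have k: "k \<in> {1..m}" using u by (auto simp: multilinear_monomials_def)
  have n: "1 \<le> n" using multilinear_monomials_pos[OF v] .
  show ?case
  proof (cases "k = i")
    case True
    have "rename (\<lambda>j. s i + j - 1) (rename t v)
      = rename (block_perm m i n s t) (rename (\<lambda>j. i + j - 1) v)"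
      unfolding rename_rename
      using v i n by (intro rename_cong) (auto simp: multilinear_monomials_def block_perm_def)
    with True show ?thesis by simp
  next
    case False
    then have "s k \<noteq> s i" using permutes_inj[OF s] by (auto dest: injD)
    with False i k n show ?thesis
      by (auto simp: block_perm_def shift_input_def)
  qed
qed

section \<open>Permutations induced on the inputs of a partial composition\<close>

lemma shift_input_neq: "k \<noteq> i \<Longrightarrow> l \<noteq> i \<Longrightarrow> k \<noteq> l \<Longrightarrow> shift_input i n k \<noteq> shift_input i n l"
  unfolding shift_input_def by auto

text \<open>Needed to pass equivariance to a quotient, because a homomorphism respects the action of
  permutations only. Injectivity suffices: an injective self-map of a finite interval is
  onto.\<close>

lemma block_perm_permutes:
  assumes i: "i \<in> {1..m}" and s: "s permutes {1..m}" and t: "t permutes {1..n}"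
  shows "block_perm m i n s t permutes {1..m + n - 1}"
proof -
  have sin: "k \<in> {1..m} \<Longrightarrow> s k \<in> {1..m}" and tin: "k \<in> {1..n} \<Longrightarrow> t k \<in> {1..n}" for k
    using s t by (simp_all only: permutes_in_image)
  have sinj: "s k = s l \<Longrightarrow> k = l" and tinj: "t k = t l \<Longrightarrow> k = l" for k l
    using permutes_inj[OF s] permutes_inj[OF t] by (auto dest: injD)
  have d: "s h \<noteq> s i" if "h \<noteq> i" for h using sinj that by blast
  have image: "block_perm m i n s t k \<in> {1..m + n - 1}" if k: "k \<in> {1..m + n - 1}" for k
  proof -
    consider "k < i" | "i \<le> k" "k < i + n" | "i + n \<le> k" by linarith
    then show ?thesis
    proof cases
      case 1
      then show ?thesis using sin[of k] sin[of i] d[of k] k i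
        by (auto simp: block_perm_def shift_input_def)
    next
      case 2
      then have "k + 1 - i \<in> {1..n}" by auto
      from tin[OF this] show ?thesis using 2 sin[of i] k i
        by (auto simp: block_perm_def shift_input_def)
    next
      case 3
      then have "k + 1 - n \<in> {1..m}" "k + 1 - n \<noteq> i" using k i by auto
      from sin[OF this(1)] d[OF this(2)] show ?thesis using 3 sin[of i] k i
        by (auto simp: block_perm_def shift_input_def)
    qed
  qed
  have inj: "inj_on (block_perm m i n s t) {1..m + n - 1}"
  proof (rule linorder_inj_onI')
    fix k l assume kl: "k \<in> {1..m + n - 1}" "l \<in> {1..m + n - 1}" "k < l"
    have si: "s i \<in> {1..m}" using sin i .
    \<comment> \<open>The inputs fall into three ranges (before, inside and after the block); an
      ordered pair \<open>k < l\<close> occupies them in one of six ways.\<close>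
    consider "l < i" | "k < i" "i \<le> l" "l < i + n" | "k < i" "i + n \<le> l"
      | "i \<le> k" "l < i + n" | "i \<le> k" "k < i + n" "i + n \<le> l" | "i + n \<le> k"
      using \<open>k < l\<close> by linarith
    then show "block_perm m i n s t k \<noteq> block_perm m i n s t l"
    proof cases
      case 1
      then have "s k \<noteq> s l" using kl sinj[of k l] by auto
      then show ?thesis using 1 kl si d[of k] d[of l] sin[of k] sin[of l] i
        by (auto simp: block_perm_def shift_input_def)
    next
      case 2
      then have "l + 1 - i \<in> {1..n}" by auto
      from tin[OF this] show ?thesis using 2 kl si d[of k] sin[of k] i
        by (auto simp: block_perm_def shift_input_def)
    next
      case 3
      then have "l + 1 - n \<in> {1..m}" "l + 1 - n \<noteq> i" "s (l + 1 - n) \<noteq> s k"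
        using kl i sinj[of "l + 1 - n" k] by auto
      from sin[OF this(1)] d[OF this(2)] this(3) show ?thesis
        using 3 kl si d[of k] sin[of k] i
        by (auto simp: block_perm_def shift_input_def)
    next
      case 4
      then have "k + 1 - i \<in> {1..n}" "l + 1 - i \<in> {1..n}" "t (k + 1 - i) \<noteq> t (l + 1 - i)"
        using kl tinj[of "k + 1 - i" "l + 1 - i"] by auto
      \<comment> \<open>Values of \<open>t\<close> are at least 1, so subtracting 1 does not
        truncate and distinct values stay distinct.\<close>
      moreover have "s i + a - 1 \<noteq> s i + b - 1" if "a \<noteq> b" "a \<in> {1..n}" "b \<in> {1..n}" for a b
        using that by auto
      ultimately have "s i + t (k + 1 - i) - 1 \<noteq> s i + t (l + 1 - i) - 1"
        using tin by blast
      then show ?thesis using 4 kl by (simp add: block_perm_def)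
    next
      case 5
      then have "k + 1 - i \<in> {1..n}" "l + 1 - n \<in> {1..m}" "l + 1 - n \<noteq> i" using kl by auto
      from tin[OF this(1)] sin[OF this(2)] d[OF this(3)] show ?thesis using 5 kl si i
        by (auto simp: block_perm_def shift_input_def)
    next
      case 6
      then have "k + 1 - n \<in> {1..m}" "l + 1 - n \<in> {1..m}" "k + 1 - n \<noteq> i" "l + 1 - n \<noteq> i"
        "s (k + 1 - n) \<noteq> s (l + 1 - n)"
        using kl i sinj[of "k + 1 - n" "l + 1 - n"] by auto
      then have "shift_input (s i) n (s (k + 1 - n)) \<noteq> shift_input (s i) n (s (l + 1 - n))"
        using d by (intro shift_input_neq) auto
      then show ?thesis using 6 kl by (simp add: block_perm_def)
    qed
  qed
  have "block_perm m i n s t ` {1..m + n - 1} = {1..m + n - 1}"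
    using image by (intro endo_inj_surj inj) auto
  with inj have "bij_betw (block_perm m i n s t) {1..m + n - 1} {1..m + n - 1}"
    by (simp add: bij_betw_def)
  then show ?thesis
    by (rule bij_imp_permutes) (auto simp: block_perm_def)
qed

section \<open>Mirror images of planar trees\<close>

primrec flip :: "monomial \<Rightarrow> monomial" where
  "flip (Var k) = Var k"
| "flip (Prod u v) = Prod (flip v) (flip u)"

lemma flip_flip: "flip (flip u) = u"
  by (induction u) auto

lemma variables_flip: "variables (flip u) = rev (variables u)"
  by (induction u) auto

lemma flip_substitute: "flip (substitute f u) = substitute (\<lambda>k. flip (f k)) (flip u)"
  by (induction u) auto

lemma flip_rename: "flip (rename s u) = rename s (flip u)"
  by (induction u) auto

lemma flip_multilinear: "u \<in> multilinear_monomials n \<Longrightarrow> flip u \<in> multilinear_monomials n"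
  by (simp add: multilinear_monomials_def variables_flip)

text \<open>Grafting addresses leaves by their labels and not by their position in the plane, so
  mirroring commutes with it at the same input \<open>i\<close>.\<close>

lemma flip_graft: "flip (graft i n u v) = graft i n (flip u) (flip v)"
  by (simp add: graft_def flip_substitute flip_rename if_distrib cong: if_cong)

section \<open>The free operad\<close>

text \<open>The passage from trees to polynomials. The support is confined to \<open>S\<close>
  because the tree identities hold only for multilinear trees; an additive identity then needs
  checking on single trees of \<open>S\<close> alone.\<close>

lemma poly_mapping_induct [consumes 1, case_names zero single add]:
  fixes p :: "'a \<Rightarrow>\<^sub>0 'b::comm_monoid_add"
  assumes keys: "Poly_Mapping.keys p \<subseteq> S"
    and zero: "P 0"
    and single: "\<And>u c. u \<in> S \<Longrightarrow> P (Poly_Mapping.single u c)"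
    and add: "\<And>p q. P p \<Longrightarrow> P q \<Longrightarrow> P (p + q)"
  shows "P p"
proof -
  have "P (\<Sum>u\<in>A. Poly_Mapping.single u (Poly_Mapping.lookup p u))"
    if "finite A" "A \<subseteq> S" for A
    using that by (induction) (auto intro: zero single add)
  moreover have "p = (\<Sum>u\<in>Poly_Mapping.keys p. Poly_Mapping.single u (Poly_Mapping.lookup p u))"
    by (intro poly_mapping_eqI)
      (auto simp: lookup_sum lookup_single when_def in_keys_iff)
  ultimately show ?thesis using keys by (metis finite_keys)
qed

section \<open>Scalar multiples and (bi)linear extension from basis trees\<close>

definition scale :: "complex \<Rightarrow> ('a \<Rightarrow>\<^sub>0 complex) \<Rightarrow> ('a \<Rightarrow>\<^sub>0 complex)" where
  "scale c = Poly_Mapping.map (\<lambda>a. c * a)"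

lemma lookup_scale [simp]: "Poly_Mapping.lookup (scale c p) u = c * Poly_Mapping.lookup p u"
  by (auto simp: scale_def Poly_Mapping.map.rep_eq when_def)

lemma scale_zero [simp]: "scale c 0 = 0"
  by (intro poly_mapping_eqI) auto

lemma scale_single [simp]: "scale c (Poly_Mapping.single u a) = Poly_Mapping.single u (c * a)"
  by (intro poly_mapping_eqI) (auto simp: lookup_single when_def)

lemma scale_add [simp]: "scale c (p + q) = scale c p + scale c q"
  by (intro poly_mapping_eqI) (auto simp: lookup_add algebra_simps)

definition lin :: "('a \<Rightarrow> 'b) \<Rightarrow> ('a \<Rightarrow>\<^sub>0 complex) \<Rightarrow> ('b \<Rightarrow>\<^sub>0 complex)" where
  "lin f p = (\<Sum>u \<in> Poly_Mapping.keys p. Poly_Mapping.single (f u) (Poly_Mapping.lookup p u))"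

lemma lin_zero [simp]: "lin f 0 = 0"
  by (simp add: lin_def)

lemma lin_single [simp]: "lin f (Poly_Mapping.single u c) = Poly_Mapping.single (f u) c"
  by (simp add: lin_def)

text \<open>Terms may cancel in \<open>p + q\<close>, so the index sets of the three sums differ;
  this is harmless because a zero coefficient contributes a zero summand.\<close>

lemma lin_add [simp]: "lin f (p + q) = lin f p + lin f q"
  unfolding lin_def by (rule setsum_keys_plus_distrib) (auto simp: single_add)

lemma lin_scale: "lin f (scale c p) = scale c (lin f p)"
  using subset_UNIV by (induction p rule: poly_mapping_induct) auto

definition bilin ::
    "('a \<Rightarrow> 'b \<Rightarrow> 'd) \<Rightarrow> ('a \<Rightarrow>\<^sub>0 complex) \<Rightarrow> ('b \<Rightarrow>\<^sub>0 complex) \<Rightarrow> ('d \<Rightarrow>\<^sub>0 complex)" where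
  "bilin g p q = (\<Sum>u \<in> Poly_Mapping.keys p. \<Sum>v \<in> Poly_Mapping.keys q.
     Poly_Mapping.single (g u v) (Poly_Mapping.lookup p u * Poly_Mapping.lookup q v))"

lemma bilin_zero [simp]: "bilin g 0 q = 0" "bilin g p 0 = 0"
  by (simp_all add: bilin_def)

lemma bilin_single [simp]:
  "bilin g (Poly_Mapping.single u a) (Poly_Mapping.single v b) = Poly_Mapping.single (g u v) (a * b)"
  by (simp add: bilin_def)

lemma bilin_add_left [simp]: "bilin g (p + p') q = bilin g p q + bilin g p' q"
  unfolding bilin_def
  by (rule setsum_keys_plus_distrib) (auto simp: single_add algebra_simps sum.distrib)

lemma bilin_add_right [simp]: "bilin g p (q + q') = bilin g p q + bilin g p q'"
proof -
  have swap: "bilin g p q = bilin (\<lambda>v u. g u v) q p" for q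
    unfolding bilin_def by (subst sum.swap) (simp add: mult.commute)
  show ?thesis by (simp add: swap)
qed

lemma bilin_scale_left: "bilin g (scale c p) q = scale c (bilin g p q)"
  using subset_UNIV
proof (induction p rule: poly_mapping_induct)
  case (single u a)
  show ?case using subset_UNIV by (induction q rule: poly_mapping_induct) (auto simp: ac_simps)
qed auto

lemma bilin_scale_right: "bilin g p (scale c q) = scale c (bilin g p q)"
  using subset_UNIV
proof (induction p rule: poly_mapping_induct)
  case (single u a)
  show ?case using subset_UNIV by (induction q rule: poly_mapping_induct) (auto simp: ac_simps)
qed auto

text \<open>Replaces the raw sums of the definition by \<open>scale\<close>, \<open>lin\<close> and
  \<open>bilin\<close>, for which rules on sums and on single trees are available.\<close>

lemma free_operad_simps [simp]:
  "operad_carrier free_operad n = {p. Poly_Mapping.keys p \<subseteq> multilinear_monomials n}"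
  "\<zero>\<^bsub>arity_space free_operad n\<^esub> = 0"
  "x \<oplus>\<^bsub>arity_space free_operad n\<^esub> y = x + y"
  "c \<odot>\<^bsub>arity_space free_operad n\<^esub> x = scale c x"
  "sym_act free_operad n s = lin (rename s)"
  "part_comp free_operad m i n = bilin (graft i n)"
  "op_unit free_operad = Poly_Mapping.single (Var 1) 1"
  by (auto simp: free_operad_def scale_def lin_def bilin_def fun_eq_iff)

lemma keys_add_subset:
  "Poly_Mapping.keys p \<subseteq> S \<Longrightarrow> Poly_Mapping.keys q \<subseteq> S \<Longrightarrow> Poly_Mapping.keys (p + q) \<subseteq> S"
  using keys_add[of p q] by blast

lemma keys_scale_subset: "Poly_Mapping.keys p \<subseteq> S \<Longrightarrow> Poly_Mapping.keys (scale c p) \<subseteq> S"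
  by (auto simp: in_keys_iff)

lemma keys_lin_subset:
  assumes "Poly_Mapping.keys p \<subseteq> S" "\<And>u. u \<in> S \<Longrightarrow> f u \<in> T"
  shows "Poly_Mapping.keys (lin f p) \<subseteq> T"
  using assms(1)
  by (induction p rule: poly_mapping_induct) (auto intro: assms(2) dest: subsetD[OF keys_add])

lemma keys_bilin_subset:
  assumes "Poly_Mapping.keys p \<subseteq> S" "Poly_Mapping.keys q \<subseteq> T"
    "\<And>u v. u \<in> S \<Longrightarrow> v \<in> T \<Longrightarrow> g u v \<in> U"
  shows "Poly_Mapping.keys (bilin g p q) \<subseteq> U"
  using assms(1)
proof (induction p rule: poly_mapping_induct)
  case (single u a)
  show ?case using assms(2)
    by (induction q rule: poly_mapping_induct)
      (auto intro: assms(3)[OF single] dest: subsetD[OF keys_add])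
qed (auto dest: subsetD[OF keys_add])

lemma lin_comp: "lin f (lin g p) = lin (f \<circ> g) p"
  using subset_UNIV by (induction p rule: poly_mapping_induct) auto

lemma lin_ident:
  assumes "Poly_Mapping.keys p \<subseteq> S" "\<And>u. u \<in> S \<Longrightarrow> f u = u"
  shows "lin f p = p"
  using assms(1) by (induction p rule: poly_mapping_induct) (auto simp: assms(2))

text \<open>Serves twice: with renamings it gives equivariance of grafting, with \<open>flip\<close>
  it gives that mirroring respects partial composition.\<close>

lemma lin_bilin:
  assumes "Poly_Mapping.keys p \<subseteq> S" "Poly_Mapping.keys q \<subseteq> T"
    "\<And>u v. u \<in> S \<Longrightarrow> v \<in> T \<Longrightarrow> h (g u v) = g' (f u) (f' v)"
  shows "lin h (bilin g p q) = bilin g' (lin f p) (lin f' q)"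
  using assms(1)
proof (induction p rule: poly_mapping_induct)
  case (single u a)
  show ?case using assms(2)
    by (induction q rule: poly_mapping_induct) (simp_all add: assms(3)[OF single])
qed simp_all

lemma bilin_bilin_sequential:
  assumes "Poly_Mapping.keys p \<subseteq> S" "Poly_Mapping.keys q \<subseteq> T" "Poly_Mapping.keys r \<subseteq> U"
    "\<And>u v w. u \<in> S \<Longrightarrow> v \<in> T \<Longrightarrow> w \<in> U \<Longrightarrow> g (g' u v) w = h u (h' v w)"
  shows "bilin g (bilin g' p q) r = bilin h p (bilin h' q r)"
  using assms(1)
proof (induction p rule: poly_mapping_induct)
  case u: (single u a)
  show ?case using assms(2)
  proof (induction q rule: poly_mapping_induct)
    case v: (single v b)
    show ?case using assms(3)
      by (induction r rule: poly_mapping_induct) (simp_all add: assms(4)[OF u v] ac_simps)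
  qed simp_all
qed simp_all

lemma bilin_bilin_parallel:
  assumes "Poly_Mapping.keys p \<subseteq> S" "Poly_Mapping.keys q \<subseteq> T" "Poly_Mapping.keys r \<subseteq> U"
    "\<And>u v w. u \<in> S \<Longrightarrow> v \<in> T \<Longrightarrow> w \<in> U \<Longrightarrow> g (g' u v) w = h (h' u w) v"
  shows "bilin g (bilin g' p q) r = bilin h (bilin h' p r) q"
  using assms(1)
proof (induction p rule: poly_mapping_induct)
  case u: (single u a)
  show ?case using assms(2)
  proof (induction q rule: poly_mapping_induct)
    case v: (single v b)
    show ?case using assms(3)
      by (induction r rule: poly_mapping_induct) (simp_all add: assms(4)[OF u v] ac_simps)
  qed simp_all
qed simp_all

lemma complex_ring_simps [simp]:
  "carrier complex_ring = UNIV"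
  "x \<oplus>\<^bsub>complex_ring\<^esub> y = x + y"
  "x \<otimes>\<^bsub>complex_ring\<^esub> y = x * y"
  "\<one>\<^bsub>complex_ring\<^esub> = 1"
  by (simp_all add: ring_of_type_algebra_def)

lemma free_operad_module: "module complex_ring (arity_space free_operad n)"
proof (rule moduleI)
  show "cring complex_ring" by (rule cring_from_type_algebra)
  show "abelian_group (arity_space free_operad n)"
  proof (rule abelian_groupI)
    fix x assume "x \<in> operad_carrier free_operad n"
    then show "\<exists>y\<in>operad_carrier free_operad n. y \<oplus>\<^bsub>arity_space free_operad n\<^esub> x
        = \<zero>\<^bsub>arity_space free_operad n\<^esub>"
      by (intro bexI[of _ "- x"]) (auto simp: in_keys_iff)
  qed (auto simp: ac_simps intro: subsetD[OF keys_add_subset])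
qed (auto intro: subsetD[OF keys_scale_subset] poly_mapping_eqI simp: lookup_add algebra_simps)

lemma free_operad_symmetric_operad: "symmetric_operad free_operad"
proof (rule symmetric_operad.intro, goal_cases)
  case (1 n) show ?case by (rule free_operad_module)
next
  case (2 s n x) then show ?case by (simp add: keys_lin_subset[OF _ rename_multilinear])
next
  case (5 x n) then show ?case by (auto intro: lin_ident simp: rename_id)
next
  case (6 s n t x)
  have "rename s \<circ> rename t = rename (s \<circ> t)" by (simp add: fun_eq_iff rename_rename)
  then show ?case by (simp add: lin_comp)
next
  case 7 show ?case using Var_multilinear by simp
next
  case (8 i m x y n)
  then show ?case unfolding free_operad_simps mem_Collect_eq
    using graft_multilinear by (intro keys_bilin_subset) blast+
next
  case (13 x n)
  have "bilin (graft 1 n) (Poly_Mapping.single (Var 1) 1) x = x"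
    using subset_UNIV by (induction x rule: poly_mapping_induct) (auto simp: graft_Var_left[simplified])
  then show ?case by simp
next
  case (14 i n x)
  have "bilin (graft i 1) x (Poly_Mapping.single (Var 1) 1) = x"
    using subset_UNIV by (induction x rule: poly_mapping_induct) (auto simp: graft_Var_right[simplified])
  then show ?case by simp
next
  case (15 i l j m x y z n)
  note keys = 15(3-5)[unfolded free_operad_simps mem_Collect_eq]
  show ?case unfolding free_operad_simps
    by (rule bilin_bilin_sequential[OF keys]) (rule graft_assoc_sequential[OF 15(1,2)])
next
  case (16 i l k x y m z n)
  note keys = 16(4-6)[unfolded free_operad_simps mem_Collect_eq]
  show ?case unfolding free_operad_simps
    by (rule bilin_bilin_parallel[OF keys]) (rule graft_assoc_parallel[OF 16(1-3)])
next
  case (17 i m s t n x y)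
  note keys = 17(4,5)[unfolded free_operad_simps mem_Collect_eq]
  show ?case unfolding free_operad_simps
    by (rule lin_bilin[OF keys, symmetric]) (rule graft_equivariant[OF 17(1-3), symmetric])
qed (auto simp: lin_scale bilin_scale_left bilin_scale_right)

section \<open>Quotient operads\<close>

lemma operad_homD:
  assumes "operad_hom P Q \<phi>"
  shows "x \<in> operad_carrier P n \<Longrightarrow> \<phi> n x \<in> operad_carrier Q n"
    and "\<lbrakk>x \<in> operad_carrier P n; y \<in> operad_carrier P n\<rbrakk>
      \<Longrightarrow> \<phi> n (x \<oplus>\<^bsub>arity_space P n\<^esub> y) = \<phi> n x \<oplus>\<^bsub>arity_space Q n\<^esub> \<phi> n y"
    and "x \<in> operad_carrier P n
      \<Longrightarrow> \<phi> n (c \<odot>\<^bsub>arity_space P n\<^esub> x) = c \<odot>\<^bsub>arity_space Q n\<^esub> \<phi> n x"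
    and "\<lbrakk>x \<in> operad_carrier P n; s permutes {1..n}\<rbrakk>
      \<Longrightarrow> \<phi> n (sym_act P n s x) = sym_act Q n s (\<phi> n x)"
    and "\<phi> 1 (op_unit P) = op_unit Q"
    and "\<lbrakk>i \<in> {1..m}; x \<in> operad_carrier P m; z \<in> operad_carrier P n\<rbrakk>
      \<Longrightarrow> \<phi> (m + n - 1) (part_comp P m i n x z) = part_comp Q m i n (\<phi> m x) (\<phi> n z)"
  using assms unfolding operad_hom_def by blast+

text \<open>The module axioms are identities and existence statements, so they pass to a surjective
  image. \<open>N\<close> is a bare record here, which is what makes the lemma applicable to a space
  of cosets.\<close>

lemma module_image:
  assumes M: "module R M"
    and h_add: "\<And>x y. \<lbrakk>x \<in> carrier M; y \<in> carrier M\<rbrakk> \<Longrightarrow> h (x \<oplus>\<^bsub>M\<^esub> y) = h x \<oplus>\<^bsub>N\<^esub> h y"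
    and h_smult: "\<And>c x. x \<in> carrier M \<Longrightarrow> h (c \<odot>\<^bsub>M\<^esub> x) = c \<odot>\<^bsub>N\<^esub> h x"
    and h_zero: "h \<zero>\<^bsub>M\<^esub> = \<zero>\<^bsub>N\<^esub>"
    and h_surj: "carrier N = h ` carrier M"
  shows "module R N"
proof -
  interpret module R M by fact
  show ?thesis
  proof (rule moduleI)
    show "cring R" by (rule R.is_cring)
    show "abelian_group N"
    proof (rule abelian_groupI)
      fix x assume "x \<in> carrier N"
      then obtain x' where x': "x = h x'" "x' \<in> carrier M" using h_surj by auto
      then have "h (\<ominus>\<^bsub>M\<^esub> x') \<oplus>\<^bsub>N\<^esub> x = \<zero>\<^bsub>N\<^esub>"
        by (simp add: h_add[symmetric] h_zero[symmetric] M.l_neg)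
      then show "\<exists>y\<in>carrier N. y \<oplus>\<^bsub>N\<^esub> x = \<zero>\<^bsub>N\<^esub>"
        using x' h_surj by blast
    qed (auto simp: h_surj h_zero[symmetric] h_add[symmetric] M.a_ac)
  qed (auto simp: h_surj h_add[symmetric] h_smult[symmetric] smult_l_distr smult_r_distr smult_assoc1)
qed

lemma (in symmetric_operad) space_closed:
  "\<lbrakk>x \<in> operad_carrier P n; y \<in> operad_carrier P n\<rbrakk>
    \<Longrightarrow> x \<oplus>\<^bsub>arity_space P n\<^esub> y \<in> operad_carrier P n"
  "x \<in> operad_carrier P n \<Longrightarrow> c \<odot>\<^bsub>arity_space P n\<^esub> x \<in> operad_carrier P n"
  using abelian_monoid.a_closed[OF abelian_group.axioms(1)[OF module.axioms(2)[OF space]]]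
    module.smult_closed[OF space] by simp_all

text \<open>The same principle for all operad axioms, meant for the map to a quotient. The zero
  condition is a separate hypothesis: additivity alone does not give it while \<open>Q\<close> is
  not yet known to allow cancellation.\<close>

lemma symmetric_operad_image:
  assumes P: "symmetric_operad P" and hom: "operad_hom P Q \<phi>"
    and surj: "\<And>n. operad_carrier Q n = \<phi> n ` operad_carrier P n"
    and zero: "\<And>n. \<phi> n \<zero>\<^bsub>arity_space P n\<^esub> = \<zero>\<^bsub>arity_space Q n\<^esub>"
  shows "symmetric_operad Q"
proof -
  interpret P: symmetric_operad P by fact
  note h = operad_homD[OF hom]
  show ?thesis
  proof (rule symmetric_operad.intro, goal_cases)
    case (1 n)
    show ?case
      by (rule module_image[OF P.space[of n], of "\<phi> n"]) (simp_all add: h zero surj)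
  next
    case 2
    then show ?case by (auto simp: surj h(4)[symmetric] P.act_closed)
  next
    case 3
    then show ?case
      by (auto simp: surj h(2,4)[symmetric] P.act_closed P.act_add P.space_closed)
  next
    case 4
    then show ?case
      by (auto simp: surj h(3,4)[symmetric] P.act_closed P.act_smult P.space_closed)
  next
    case 5
    then show ?case
      by (auto simp: surj h(4)[symmetric] permutes_id P.act_id)
  next
    case 6
    then show ?case
      by (auto simp: surj h(4)[symmetric] permutes_compose P.act_comp P.act_closed)
  next
    case 7
    show ?case using h(1)[OF P.unit_closed] h(5) by simp
  next
    case 8
    then show ?case using P.comp_closed by (auto simp: surj h(6)[symmetric])
  next
    case (9 i m x x' y n)
    then obtain u u' v where xy: "x = \<phi> m u" "x' = \<phi> m u'" "y = \<phi> n v"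
      and c: "u \<in> operad_carrier P m" "u' \<in> operad_carrier P m" "v \<in> operad_carrier P n"
      by (auto simp: surj)
    show ?case
      unfolding xy
      using h(2)[OF c(1,2)] h(6)[OF 9(1) P.space_closed(1)[OF c(1,2)] c(3)]
        h(6)[OF 9(1) c(1,3)] h(6)[OF 9(1) c(2,3)]
        h(2)[OF P.comp_closed[OF 9(1) c(1,3)] P.comp_closed[OF 9(1) c(2,3)]]
        P.comp_add_left[OF 9(1) c]
      by simp
  next
    case (10 i m x y n y')
    then obtain u v v' where xy: "x = \<phi> m u" "y = \<phi> n v" "y' = \<phi> n v'"
      and c: "u \<in> operad_carrier P m" "v \<in> operad_carrier P n" "v' \<in> operad_carrier P n"
      by (auto simp: surj)
    show ?case
      unfolding xy
      using h(2)[OF c(2,3)] h(6)[OF 10(1) c(1) P.space_closed(1)[OF c(2,3)]]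
        h(6)[OF 10(1) c(1,2)] h(6)[OF 10(1) c(1,3)]
        h(2)[OF P.comp_closed[OF 10(1) c(1,2)] P.comp_closed[OF 10(1) c(1,3)]]
        P.comp_add_right[OF 10(1) c]
      by simp
  next
    case (11 i m x y n a)
    then obtain u v where xy: "x = \<phi> m u" "y = \<phi> n v"
      and c: "u \<in> operad_carrier P m" "v \<in> operad_carrier P n"
      by (auto simp: surj)
    show ?case
      unfolding xy
      using h(3)[OF c(1), of a] h(6)[OF 11(1) P.space_closed(2)[OF c(1)] c(2), of a]
        h(6)[OF 11(1) c] h(3)[OF P.comp_closed[OF 11(1) c], of a]
        P.comp_smult_left[OF 11(1) c, of a]
      by simp
  next
    case (12 i m x y n a)
    then obtain u v where xy: "x = \<phi> m u" "y = \<phi> n v"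
      and c: "u \<in> operad_carrier P m" "v \<in> operad_carrier P n"
      by (auto simp: surj)
    show ?case
      unfolding xy
      using h(3)[OF c(2), of a] h(6)[OF 12(1) c(1) P.space_closed(2)[OF c(2)], of a]
        h(6)[OF 12(1) c] h(3)[OF P.comp_closed[OF 12(1) c], of a]
        P.comp_smult_right[OF 12(1) c, of a]
      by simp
  next
    case (13 x n)
    then obtain u where u: "x = \<phi> n u" "u \<in> operad_carrier P n" by (auto simp: surj)
    then show ?case
      using h(6)[of 1 1 "op_unit P" u n] by (simp add: h(5)[symmetric] P.unit_closed P.unit_left
        del: One_nat_def)
  next
    case (14 i n x)
    then obtain u where u: "x = \<phi> n u" "u \<in> operad_carrier P n" by (auto simp: surj)
    then show ?case
      using h(6)[of i n u "op_unit P" 1] 14(1) by (simp add: h(5)[symmetric] P.unit_closed P.unit_right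
        del: One_nat_def)
  next
    case (15 i l j m x y z n)
    then obtain u v w where xyz: "x = \<phi> l u" "y = \<phi> m v" "z = \<phi> n w"
      and c: "u \<in> operad_carrier P l" "v \<in> operad_carrier P m" "w \<in> operad_carrier P n"
      by (auto simp: surj)
    \<comment> \<open>\<phi> is indexed by the arity, and the two bracketings yield different
      expressions for the same number; \<open>eq\<close> reconciles them.\<close>
    have ij: "i + j - 1 \<in> {1..l + m - 1}" and eq: "l + m - 1 + n - 1 = l + (m + n - 1) - 1"
      using 15(1,2) by auto
    show ?case
      unfolding xyz
      using h(6)[OF 15(1) c(1,2)] h(6)[OF ij P.comp_closed[OF 15(1) c(1,2)] c(3)]
        h(6)[OF 15(2) c(2,3)] h(6)[OF 15(1) c(1) P.comp_closed[OF 15(2) c(2,3)]]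
        P.assoc_sequential[OF 15(1,2) c]
      by (simp only: eq)
  next
    case (16 i l k x y m z n)
    then obtain u v w where xyz: "x = \<phi> l u" "y = \<phi> m v" "z = \<phi> n w"
      and c: "u \<in> operad_carrier P l" "v \<in> operad_carrier P m" "w \<in> operad_carrier P n"
      by (auto simp: surj)
    have ij: "k + m - 1 \<in> {1..l + m - 1}" "i \<in> {1..l + n - 1}"
      and eq: "l + m - 1 + n - 1 = l + n - 1 + m - 1"
      using 16(1,2,3) by auto
    show ?case
      unfolding xyz
      using h(6)[OF 16(1) c(1,2)] h(6)[OF ij(1) P.comp_closed[OF 16(1) c(1,2)] c(3)]
        h(6)[OF 16(2) c(1,3)] h(6)[OF ij(2) P.comp_closed[OF 16(2) c(1,3)] c(2)]
        P.assoc_parallel[OF 16(1-3) c]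
      by (simp only: eq)
  next
    case (17 i m s t n x y)
    then obtain u v where xy: "x = \<phi> m u" "y = \<phi> n v"
      and c: "u \<in> operad_carrier P m" "v \<in> operad_carrier P n"
      by (auto simp: surj)
    have si: "s i \<in> {1..m}" using 17(1,2) by (simp only: permutes_in_image)
    show ?case
      unfolding xy
      using h(6)[OF 17(1) c] h(4)[OF c(1) 17(2)] h(4)[OF c(2) 17(3)]
        h(6)[OF si P.act_closed[OF 17(2) c(1)] P.act_closed[OF 17(3) c(2)]]
        h(4)[OF P.comp_closed[OF 17(1) c] block_perm_permutes[OF 17(1,2,3)]]
        P.equivariant[OF 17(1,2,3) c]
      by simp
  qed
qed

section \<open>Coset operations and the quotient operad\<close>

lemma UN_eq_const: "a \<in> A \<Longrightarrow> (\<And>x. x \<in> A \<Longrightarrow> f x = c) \<Longrightarrow> (\<Union>x\<in>A. f x) = c"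
  by blast

definition quotient_map :: "('a, 'c) operad_scheme \<Rightarrow> (nat \<Rightarrow> 'a set) \<Rightarrow> nat \<Rightarrow> 'a \<Rightarrow> 'a set" where
  "quotient_map P I n x = I n +>\<^bsub>arity_space P n\<^esub> x"

lemma quotient_operad_simps:
  "c \<odot>\<^bsub>arity_space (quotient_operad P I) n\<^esub> A
     = (\<Union>x\<in>A. quotient_map P I n (c \<odot>\<^bsub>arity_space P n\<^esub> x))"
  "sym_act (quotient_operad P I) n s A = (\<Union>x\<in>A. quotient_map P I n (sym_act P n s x))"
  "part_comp (quotient_operad P I) m i n A B
     = (\<Union>x\<in>A. \<Union>y\<in>B. quotient_map P I (m + n - 1) (part_comp P m i n x y))"
  "op_unit (quotient_operad P I) = quotient_map P I 1 (op_unit P)"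
  by (simp_all add: quotient_operad_def quotient_map_def)

lemma operad_idealD:
  assumes "operad_ideal P I"
  shows "submodule (I n) complex_ring (arity_space P n)"
    and "\<lbrakk>s permutes {1..n}; x \<in> I n\<rbrakk> \<Longrightarrow> sym_act P n s x \<in> I n"
    and "\<lbrakk>i \<in> {1..m}; y \<in> operad_carrier P m; z \<in> operad_carrier P n; y \<in> I m \<or> z \<in> I n\<rbrakk>
      \<Longrightarrow> part_comp P m i n y z \<in> I (m + n - 1)"
  using assms unfolding operad_ideal_def sym_submodule_def by blast+

lemma submodule_abelian_subgroup:
  assumes "module R M" "submodule H R M"
  shows "abelian_subgroup H M"
  by (rule abelian_subgroupI3)
    (use assms in \<open>auto simp: module_def submodule_def additive_subgroup_def\<close>)

context symmetric_operad
begin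

text \<open>The form in which independence of representatives is used: a result may be altered by an
  element of the ideal.\<close>

lemma quotient_map_eqI:
  assumes I: "operad_ideal P I" and x: "x \<in> operad_carrier P n" and h: "h \<in> I n"
    and y: "y = h \<oplus>\<^bsub>arity_space P n\<^esub> x"
  shows "quotient_map P I n y = quotient_map P I n x"
proof -
  interpret abelian_subgroup "I n" "arity_space P n"
    using submodule_abelian_subgroup[OF space operad_idealD(1)[OF I]] .
  have "y \<in> I n +>\<^bsub>arity_space P n\<^esub> x" using y h by (auto simp: a_r_coset_def')
  then show ?thesis
    using a_repr_independence'[OF _ x] by (simp add: quotient_map_def)
qed

lemma quotient_map_ex:
  assumes "y \<in> quotient_map P I n x"
  obtains h where "h \<in> I n" "y = h \<oplus>\<^bsub>arity_space P n\<^esub> x"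
  using assms by (auto simp: quotient_map_def a_r_coset_def')

lemma quotient_map_self:
  assumes I: "operad_ideal P I" and x: "x \<in> operad_carrier P n"
  shows "x \<in> quotient_map P I n x"
proof -
  interpret abelian_subgroup "I n" "arity_space P n"
    using submodule_abelian_subgroup[OF space operad_idealD(1)[OF I]] .
  show ?thesis using x by (simp add: quotient_map_def a_rcos_self)
qed

lemma operad_ideal_subset: "operad_ideal P I \<Longrightarrow> I n \<subseteq> operad_carrier P n"
  using module.submoduleE(1)[OF space operad_idealD(1)] .

lemma quotient_carrier:
  "operad_carrier (quotient_operad P I) n = quotient_map P I n ` operad_carrier P n"
  by (auto simp: quotient_operad_def A_RCOSETS_def' quotient_map_def)

text \<open>The content is well-definedness. Changing a representative by an ideal element changes
  each result by an ideal element, so the unions in \<open>quotient_operad\<close> run over constant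
  nonempty families and collapse by \<open>UN_eq_const\<close>.\<close>

lemma quotient_map_hom:
  assumes I: "operad_ideal P I"
  shows "operad_hom P (quotient_operad P I) (quotient_map P I)"
proof -
  note sub = subsetD[OF operad_ideal_subset[OF I]]
  note idl = operad_idealD[OF I]
  note self = quotient_map_self[OF I]
  show ?thesis
    unfolding operad_hom_def
  proof (intro conjI allI ballI impI, goal_cases)
    case (1 n x)
    then show ?case by (simp add: quotient_carrier)
  next
    case (2 n x y)
    interpret abelian_subgroup "I n" "arity_space P n"
      using submodule_abelian_subgroup[OF space idl(1)] .
    show ?case using 2 by (simp add: quotient_operad_def quotient_map_def a_rcos_sum)
  next
    case (3 n c x)
    have eq: "quotient_map P I n (c \<odot>\<^bsub>arity_space P n\<^esub> y) = quotient_map P I n (c \<odot>\<^bsub>arity_space P n\<^esub> x)"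
      if "y \<in> quotient_map P I n x" for y
    proof -
      from that obtain h where h: "h \<in> I n" "y = h \<oplus>\<^bsub>arity_space P n\<^esub> x" by (rule quotient_map_ex)
      then show ?thesis using 3
        by (intro quotient_map_eqI[OF I, where h = "c \<odot>\<^bsub>arity_space P n\<^esub> h"] space_closed)
          (simp_all add: module.smult_r_distr[OF space] sub submodule.smult_closed[OF idl(1)])
    qed
    show ?case
      unfolding quotient_operad_simps by (rule UN_eq_const[OF self[OF 3] eq, symmetric])
  next
    case (4 n s x)
    have eq: "quotient_map P I n (sym_act P n s y) = quotient_map P I n (sym_act P n s x)"
      if "y \<in> quotient_map P I n x" for y
    proof -
      from that obtain h where h: "h \<in> I n" "y = h \<oplus>\<^bsub>arity_space P n\<^esub> x" by (rule quotient_map_ex)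
      then show ?thesis using 4
        by (intro quotient_map_eqI[OF I, where h = "sym_act P n s h"] act_closed)
          (simp_all add: act_add sub idl)
    qed
    show ?case
      unfolding quotient_operad_simps by (rule UN_eq_const[OF self[OF 4(1)] eq, symmetric])
  next
    case 5
    show ?case by (simp only: quotient_operad_simps)
  next
    case (6 m n i x y)
    have eq: "quotient_map P I (m + n - 1) (part_comp P m i n x' y')
        = quotient_map P I (m + n - 1) (part_comp P m i n x y)"
      if "x' \<in> quotient_map P I m x" "y' \<in> quotient_map P I n y" for x' y'
    proof -
      from that(1) obtain h where h: "h \<in> I m" "x' = h \<oplus>\<^bsub>arity_space P m\<^esub> x" by (rule quotient_map_ex)
      from that(2) obtain k where k: "k \<in> I n" "y' = k \<oplus>\<^bsub>arity_space P n\<^esub> y" by (rule quotient_map_ex)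
      have y': "y' \<in> operad_carrier P n" using k 6 sub by (simp add: space_closed)
      \<comment> \<open>The representatives are replaced one at a time; a composition lies in the
        ideal as soon as either argument does, so each replacement is allowed.\<close>
      have "quotient_map P I (m + n - 1) (part_comp P m i n x' y')
        = quotient_map P I (m + n - 1) (part_comp P m i n x y')"
        using 6 h y'
        by (intro quotient_map_eqI[OF I, where h = "part_comp P m i n h y'"] comp_closed idl)
          (simp_all add: comp_add_left sub)
      also have "\<dots> = quotient_map P I (m + n - 1) (part_comp P m i n x y)"
        using 6 k
        by (intro quotient_map_eqI[OF I, where h = "part_comp P m i n x k"] comp_closed idl)
          (simp_all add: comp_add_right sub)
      finally show ?thesis .
    qed
    show ?case
      unfolding quotient_operad_simps
      by (rule UN_eq_const[OF self[OF 6(2)] UN_eq_const[OF self[OF 6(3)] eq], symmetric])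
  qed
qed

lemma quotient_symmetric_operad:
  assumes I: "operad_ideal P I"
  shows "symmetric_operad (quotient_operad P I)"
proof (rule symmetric_operad_image[OF symmetric_operad_axioms quotient_map_hom[OF I] quotient_carrier])
  fix n
  interpret abelian_subgroup "I n" "arity_space P n"
    using submodule_abelian_subgroup[OF space operad_idealD(1)[OF I]] .
  show "quotient_map P I n \<zero>\<^bsub>arity_space P n\<^esub> = \<zero>\<^bsub>arity_space (quotient_operad P I) n\<^esub>"
    using a_coset_add_zero[OF a_subset] by (simp add: quotient_map_def quotient_operad_def)
qed

lemma carrier_operad_ideal: "operad_ideal P (operad_carrier P)"
  unfolding operad_ideal_def sym_submodule_def
  by (intro conjI allI ballI impI)
    (assumption | rule module.carrier_is_submodule[OF space] act_closed comp_closed)+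

lemma sym_submodule_Inter:
  assumes "\<And>N. N \<in> \<N> \<Longrightarrow> sym_submodule P n N" "\<N> \<noteq> {}"
  shows "sym_submodule P n (\<Inter>\<N>)"
proof -
  interpret module complex_ring "arity_space P n" by (rule space)
  have sub: "submodule N complex_ring (arity_space P n)" if "N \<in> \<N>" for N
    using assms(1)[OF that] by (simp add: sym_submodule_def)
  have "submodule (\<Inter>\<N>) complex_ring (arity_space P n)"
  proof (rule submoduleI)
    show "\<Inter>\<N> \<subseteq> operad_carrier P n" using assms(2) submoduleE(1)[OF sub] by blast
    show "\<zero>\<^bsub>arity_space P n\<^esub> \<in> \<Inter>\<N>"
      using subgroup.one_closed[OF submodule.axioms(1)[OF sub]] by simp
  next
    fix a assume "a \<in> \<Inter>\<N>"
    then show "\<ominus>\<^bsub>arity_space P n\<^esub> a \<in> \<Inter>\<N>"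
      by (intro InterI submoduleE(3)[OF sub]) auto
  next
    fix a b assume "a \<in> \<Inter>\<N>" "b \<in> \<Inter>\<N>"
    then show "a \<oplus>\<^bsub>arity_space P n\<^esub> b \<in> \<Inter>\<N>"
      by (intro InterI submoduleE(5)[OF sub]) auto
  next
    fix c x assume "c \<in> carrier complex_ring" "x \<in> \<Inter>\<N>"
    then show "c \<odot>\<^bsub>arity_space P n\<^esub> x \<in> \<Inter>\<N>"
      by (intro InterI submoduleE(4)[OF sub]) auto
  qed
  then show ?thesis using assms(1) by (auto simp: sym_submodule_def)
qed

text \<open>Since \<open>G\<close> lies in the carrier, the whole operad is one of the ideals
  intersected. An empty family would have intersection \<open>UNIV\<close>, which need not be a
  submodule.\<close>

lemma operad_ideal_gen_ideal:
  assumes "G \<subseteq> operad_carrier P k"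
  shows "operad_ideal P (operad_ideal_gen P k G)"
proof -
  have mem: "x \<in> operad_ideal_gen P k G n \<longleftrightarrow> (\<forall>I. operad_ideal P I \<and> G \<subseteq> I k \<longrightarrow> x \<in> I n)" for x n
    by (auto simp: operad_ideal_gen_def)
  show ?thesis
    unfolding operad_ideal_def
  proof (intro conjI allI ballI impI, goal_cases)
    case (1 n)
    show ?case
      unfolding operad_ideal_gen_def
      using assms carrier_operad_ideal
      by (intro sym_submodule_Inter) (auto simp: operad_ideal_def)
  next
    case (2 m n i x y)
    then show ?case unfolding mem by (meson operad_idealD(3))
  qed
qed

end

lemma operad_ideal_gen_incl: "G \<subseteq> operad_ideal_gen P k G k"
  by (auto simp: operad_ideal_gen_def)

lemma operad_ideal_gen_least: "\<lbrakk>operad_ideal P I; G \<subseteq> I k\<rbrakk> \<Longrightarrow> operad_ideal_gen P k G n \<subseteq> I n"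
  by (auto simp: operad_ideal_gen_def)

text \<open>\<open>operad_hom\<close> asks only for additivity. The image of zero equals its own
  double, and the target group allows cancellation.\<close>

lemma operad_hom_zero:
  assumes "symmetric_operad P" "symmetric_operad Q" "operad_hom P Q \<phi>"
  shows "\<phi> n \<zero>\<^bsub>arity_space P n\<^esub> = \<zero>\<^bsub>arity_space Q n\<^esub>"
proof -
  interpret P: module complex_ring "arity_space P n" by (rule symmetric_operad.space) fact
  interpret Q: module complex_ring "arity_space Q n" by (rule symmetric_operad.space) fact
  show ?thesis
    using operad_homD(1,2)[OF assms(3) P.zero_closed] P.zero_closed
    by (metis P.l_zero Q.add.r_cancel_one')
qed

text \<open>Combined with minimality of a generated ideal, this shows that a homomorphism maps a
  generated ideal into \<open>I\<close> once it maps the generators there.\<close>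

lemma operad_ideal_preimage:
  assumes P: "symmetric_operad P" and Q: "symmetric_operad Q" and hom: "operad_hom P Q \<phi>"
    and I: "operad_ideal Q I"
  shows "operad_ideal P (\<lambda>n. {x \<in> operad_carrier P n. \<phi> n x \<in> I n})"
proof -
  interpret P: symmetric_operad P by fact
  interpret Q: symmetric_operad Q by fact
  note h = operad_homD[OF hom]
  note idl = operad_idealD[OF I]
  have "submodule {x \<in> operad_carrier P n. \<phi> n x \<in> I n} complex_ring (arity_space P n)" for n
  proof -
    interpret PM: module complex_ring "arity_space P n" by (rule P.space)
    interpret QM: module complex_ring "arity_space Q n" by (rule Q.space)
    note s = QM.submoduleE[OF idl(1)]
    have z: "\<phi> n \<zero>\<^bsub>arity_space P n\<^esub> = \<zero>\<^bsub>arity_space Q n\<^esub>"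
      by (rule operad_hom_zero[OF P Q hom])
    show ?thesis
    proof (rule PM.submoduleI)
      fix a assume "a \<in> {x \<in> operad_carrier P n. \<phi> n x \<in> I n}"
      then have a: "a \<in> operad_carrier P n" "\<phi> n a \<in> I n" by auto
      then have "\<phi> n (\<ominus>\<^bsub>arity_space P n\<^esub> a) \<oplus>\<^bsub>arity_space Q n\<^esub> \<phi> n a = \<zero>\<^bsub>arity_space Q n\<^esub>"
        by (simp add: h(2)[symmetric] PM.l_neg z)
      then have "\<phi> n (\<ominus>\<^bsub>arity_space P n\<^esub> a) = \<ominus>\<^bsub>arity_space Q n\<^esub> \<phi> n a"
        using a by (intro QM.minus_equality[symmetric]) (simp_all add: h(1))
      then show "\<ominus>\<^bsub>arity_space P n\<^esub> a \<in> {x \<in> operad_carrier P n. \<phi> n x \<in> I n}"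
        using a s(3) by simp
    qed (use s h in \<open>auto simp: z subgroup.one_closed[OF submodule.axioms(1)[OF idl(1)], simplified]\<close>)
  qed
  then show ?thesis
    unfolding operad_ideal_def sym_submodule_def
    using h idl P.act_closed P.comp_closed by auto
qed

text \<open>The induced map is the direct image of a coset, so no representatives are chosen. Since
  \<phi> is additive and carries \<open>I\<close> onto \<open>J\<close>, the image of the coset of
  \<open>x\<close> is exactly the coset of \<open>\<phi> n x\<close>.\<close>

lemma quotient_operads_isomorphic:
  assumes P: "symmetric_operad P" and Q: "symmetric_operad Q" and hom: "operad_hom P Q \<phi>"
    and bij: "\<And>n. bij_betw (\<phi> n) (operad_carrier P n) (operad_carrier Q n)"
    and I: "operad_ideal P I" and J: "operad_ideal Q J" and IJ: "\<And>n. \<phi> n ` I n = J n"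
  shows "operads_isomorphic (quotient_operad P I) (quotient_operad Q J)"
proof -
  interpret P: symmetric_operad P by fact
  interpret Q: symmetric_operad Q by fact
  note h = operad_homD[OF hom]
  note p = operad_homD[OF P.quotient_map_hom[OF I]]
  note q = operad_homD[OF Q.quotient_map_hom[OF J]]
  have img: "\<phi> n ` quotient_map P I n x = quotient_map Q J n (\<phi> n x)"
    if "x \<in> operad_carrier P n" for n x
  proof -
    have "\<phi> n (k \<oplus>\<^bsub>arity_space P n\<^esub> x) = \<phi> n k \<oplus>\<^bsub>arity_space Q n\<^esub> \<phi> n x" if "k \<in> I n" for k
      using h(2)[OF subsetD[OF P.operad_ideal_subset[OF I] that] \<open>x \<in> operad_carrier P n\<close>] .
    then show ?thesis
      by (auto simp: quotient_map_def a_r_coset_def' IJ[symmetric] image_iff)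
  qed
  have "operad_hom (quotient_operad P I) (quotient_operad Q J) (\<lambda>n A. \<phi> n ` A)"
    unfolding operad_hom_def P.quotient_carrier Q.quotient_carrier
  proof (intro conjI allI ballI impI, goal_cases)
    case 1
    then show ?case using img h(1) by blast
  next
    case (2 n A B)
    then obtain x y where A: "A = quotient_map P I n x" and B: "B = quotient_map P I n y"
      and c: "x \<in> operad_carrier P n" "y \<in> operad_carrier P n" by blast
    show ?case
      using p(2)[OF c] q(2)[OF h(1)[OF c(1)] h(1)[OF c(2)]] h(2)[OF c]
        img[OF P.space_closed(1)[OF c]] img[OF c(1)] img[OF c(2)]
      by (simp add: A B)
  next
    case (3 n a A)
    then obtain x where A: "A = quotient_map P I n x" and c: "x \<in> operad_carrier P n" by blast
    show ?case
      using p(3)[OF c, of a] q(3)[OF h(1)[OF c], of a] h(3)[OF c, of a]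
        img[OF P.space_closed(2)[OF c], of a] img[OF c]
      by (simp add: A)
  next
    case (4 n s A)
    then obtain x where A: "A = quotient_map P I n x" and c: "x \<in> operad_carrier P n" by blast
    show ?case
      using p(4)[OF c 4(2)] q(4)[OF h(1)[OF c] 4(2)] h(4)[OF c 4(2)]
        img[OF P.act_closed[OF 4(2) c]] img[OF c]
      by (simp add: A)
  next
    case 5
    show ?case using img[OF P.unit_closed] h(5) p(5) q(5) by simp
  next
    case (6 m n i A B)
    then obtain x y where A: "A = quotient_map P I m x" and B: "B = quotient_map P I n y"
      and c: "x \<in> operad_carrier P m" "y \<in> operad_carrier P n" by blast
    show ?case
      using p(6)[OF 6(1) c] q(6)[OF 6(1) h(1)[OF c(1)] h(1)[OF c(2)]] h(6)[OF 6(1) c]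
        img[OF P.comp_closed[OF 6(1) c]] img[OF c(1)] img[OF c(2)]
      by (simp add: A B)
  qed
  moreover have "bij_betw (\<lambda>A. \<phi> n ` A) (operad_carrier (quotient_operad P I) n)
      (operad_carrier (quotient_operad Q J) n)" for n
  proof -
    \<comment> \<open>Cosets are subsets of the carrier, where \<open>\<phi> n\<close> is injective,
      so equal direct images come from equal cosets.\<close>
    have "A \<subseteq> operad_carrier P n" if "A \<in> operad_carrier (quotient_operad P I) n" for A
      using that P.space_closed(1) subsetD[OF P.operad_ideal_subset[OF I]]
      by (auto simp: P.quotient_carrier quotient_map_def a_r_coset_def')
    then have "inj_on (\<lambda>A. \<phi> n ` A) (operad_carrier (quotient_operad P I) n)"
      using bij_betw_imp_inj_on[OF bij[of n]] by (intro inj_onI) (meson inj_on_image_eq_iff)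
    moreover have "(\<lambda>A. \<phi> n ` A) ` operad_carrier (quotient_operad P I) n
        = operad_carrier (quotient_operad Q J) n"
      unfolding P.quotient_carrier Q.quotient_carrier
        bij_betw_imp_surj_on[OF bij[of n], symmetric] image_image
      using img by (intro image_cong) auto
    ultimately show ?thesis by (simp add: bij_betw_def)
  qed
  ultimately show ?thesis
    unfolding operads_isomorphic_def
    using P.quotient_symmetric_operad[OF I] Q.quotient_symmetric_operad[OF J]
    by (intro conjI exI[of _ "\<lambda>n A. \<phi> n ` A"]) auto
qed

section \<open>The annihilator of the mock-Novikov relations\<close>

text \<open>One-line notation for a permutation of three inputs, fixing every other number as
  \<open>permutes\<close> demands. It makes the symmetric group an explicit list of six
  functions.\<close>

definition perm3 :: "nat \<Rightarrow> nat \<Rightarrow> nat \<Rightarrow> nat \<Rightarrow> nat" where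
  "perm3 a b c k = (if k = 1 then a else if k = 2 then b else if k = 3 then c else k)"

lemma perm3_simps [simp]: "perm3 a b c (Suc 0) = a" "perm3 a b c 2 = b" "perm3 a b c 3 = c"
  by (simp_all add: perm3_def)

lemma atLeastAtMost_1_3: "{1..3} = {1, 2, 3::nat}"
  by auto

lemma perm3_eq:
  "perm3 1 2 3 = id" "perm3 2 1 3 = transpose 1 2" "perm3 1 3 2 = transpose 2 3"
  "perm3 3 2 1 = transpose 1 3" "perm3 2 3 1 = transpose 1 2 \<circ> transpose 2 3"
  "perm3 3 1 2 = transpose 2 3 \<circ> transpose 1 2"
  by (auto simp: perm3_def transpose_def fun_eq_iff)

lemma sign_perm3:
  "sign (perm3 1 2 3) = 1" "sign (perm3 2 1 3) = -1" "sign (perm3 1 3 2) = -1"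
  "sign (perm3 3 2 1) = -1" "sign (perm3 2 3 1) = 1" "sign (perm3 3 1 2) = 1"
  unfolding perm3_eq
  by (simp_all add: sign_compose permutation_swap_id sign_swap_id)

lemma permutations_3:
  "{s. s permutes {1..3}} =
     {perm3 1 2 3, perm3 2 1 3, perm3 1 3 2, perm3 3 2 1, perm3 2 3 1, perm3 3 1 2}"
proof (intro equalityI subsetI)
  fix s :: "nat \<Rightarrow> nat" assume "s \<in> {s. s permutes {1..3}}"
  then have s: "s permutes {1, 2, 3}" by (simp only: atLeastAtMost_1_3 mem_Collect_eq)
  have "s k = perm3 (s 1) (s 2) (s 3) k" for k
    using permutes_not_in[OF s, of k] by (auto simp: perm3_def)
  then have "s = perm3 (s 1) (s 2) (s 3)" ..
  moreover have "s 1 \<in> {1, 2, 3}" "s 2 \<in> {1, 2, 3}" "s 3 \<in> {1, 2, 3}"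
    using permutes_in_image[OF s] by blast+
  moreover have "s 1 \<noteq> s 2" "s 1 \<noteq> s 3" "s 2 \<noteq> s 3"
    using injD[OF permutes_inj[OF s]] by fastforce+
  ultimately show "s \<in> {perm3 1 2 3, perm3 2 1 3, perm3 1 3 2, perm3 3 2 1, perm3 2 3 1, perm3 3 1 2}"
    by (metis empty_iff insertE insertI1 insertI2)
next
  fix s assume "s \<in> {perm3 1 2 3, perm3 2 1 3, perm3 1 3 2, perm3 3 2 1, perm3 2 3 1, perm3 3 1 2}"
  then show "s \<in> {s. s permutes {1..3}}"
    unfolding perm3_eq mem_Collect_eq
    by (auto intro!: permutes_compose permutes_swap_id permutes_id)
qed

lemma permutes_3_cases:
  assumes "s permutes {1..3}"
  obtains "s = perm3 1 2 3" | "s = perm3 2 1 3" | "s = perm3 1 3 2"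
    | "s = perm3 3 2 1" | "s = perm3 2 3 1" | "s = perm3 3 1 2"
  using assms permutations_3 by blast

lemma perm3_permutes:
  "perm3 1 2 3 permutes {1..3}" "perm3 2 1 3 permutes {1..3}" "perm3 1 3 2 permutes {1..3}"
  "perm3 3 2 1 permutes {1..3}" "perm3 2 3 1 permutes {1..3}" "perm3 3 1 2 permutes {1..3}"
  using permutations_3 by blast+

lemma perm3_inject: "perm3 a b c = perm3 a' b' c' \<longleftrightarrow> a = a' \<and> b = b' \<and> c = c'"
  by (metis perm3_simps)

lemma monomial_simps [simp]:
  "left_monomial a b c = left_monomial a' b' c' \<longleftrightarrow> a = a' \<and> b = b' \<and> c = c'"
  "right_monomial a b c = right_monomial a' b' c' \<longleftrightarrow> a = a' \<and> b = b' \<and> c = c'"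
  "left_monomial a b c \<noteq> right_monomial a' b' c'"
  "right_monomial a b c \<noteq> left_monomial a' b' c'"
  "rename s (left_monomial a b c) = left_monomial (s a) (s b) (s c)"
  "rename s (right_monomial a b c) = right_monomial (s a) (s b) (s c)"
  "flip (left_monomial a b c) = right_monomial c b a"
  "flip (right_monomial a b c) = left_monomial c b a"
  by (auto simp: left_monomial_def right_monomial_def)

lemma gk_pairing_explicit:
  fixes f r :: tree_poly
  defines "L \<equiv> \<lambda>a b c. Poly_Mapping.lookup f (left_monomial a b c)
      * Poly_Mapping.lookup r (left_monomial a b c)
    - Poly_Mapping.lookup f (right_monomial a b c) * Poly_Mapping.lookup r (right_monomial a b c)"
  shows "gk_pairing f r = L 1 2 3 - L 2 1 3 - L 1 3 2 - L 3 2 1 + L 2 3 1 + L 3 1 2"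
  unfolding gk_pairing_def permutations_3
  by (simp add: perm3_inject sign_perm3[simplified] L_def algebra_simps)

text \<open>The three leaves split at the root as 1 + 2 or 2 + 1, giving the two comb shapes; the
  distinct labels then form a permutation. These are the 12 basis trees.\<close>

lemma multilinear_monomials_3_cases:
  assumes t: "t \<in> multilinear_monomials 3"
  obtains s where "s permutes {1..3}" "t = left_monomial (s 1) (s 2) (s 3)"
  | s where "s permutes {1..3}" "t = right_monomial (s 1) (s 2) (s 3)"
proof -
  have d: "distinct (variables t)" and st: "set (variables t) = {1, 2, 3}"
    using t by (simp_all only: multilinear_monomials_def atLeastAtMost_1_3 mem_Collect_eq)
  have len: "length (variables t) = 3" unfolding distinct_card[OF d, symmetric] st by simp
  have pos: "0 < length (variables u)" for u using variables_nonempty by auto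
  have one: "\<exists>k. u = Var k" if "length (variables u) = 1" for u
  proof (cases u)
    case (Prod v w)
    with that pos[of v] pos[of w] show ?thesis by simp
  qed simp
  have two: "\<exists>k l. u = Prod (Var k) (Var l)" if "length (variables u) = 2" for u
  proof (cases u)
    case (Prod v w)
    with that have "length (variables v) + length (variables w) = 2" by simp
    with pos[of v] pos[of w] have "length (variables v) = 1" "length (variables w) = 1"
      by linarith+
    then obtain k l where "v = Var k" "w = Var l" using one by metis
    with Prod show ?thesis by simp
  qed (use that in simp)
  have "\<exists>a b c. t = left_monomial a b c \<or> t = right_monomial a b c"
  proof (cases t)
    case (Prod u v)
    with len have "length (variables u) + length (variables v) = 3" by simp
    with pos[of u] pos[of v] consider "length (variables u) = 1" "length (variables v) = 2"
      | "length (variables u) = 2" "length (variables v) = 1"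
      by linarith
    then show ?thesis
    proof cases
      case 1
      then obtain a b c where "u = Var a" "v = Prod (Var b) (Var c)" using one two by metis
      with Prod show ?thesis by (auto simp: right_monomial_def)
    next
      case 2
      then obtain a b c where "u = Prod (Var a) (Var b)" "v = Var c" using one two by metis
      with Prod show ?thesis by (auto simp: left_monomial_def)
    qed
  qed (use len in simp)
  then obtain a b c where abc: "t = left_monomial a b c \<or> t = right_monomial a b c" by blast
  then have vars: "variables t = [a, b, c]" by (auto simp: left_monomial_def right_monomial_def)
  have "distinct [a, b, c]" using d unfolding vars .
  moreover have "a \<in> set (variables t)" "b \<in> set (variables t)" "c \<in> set (variables t)"
    by (simp_all add: vars)
  ultimately have "perm3 a b c \<in> {s. s permutes {1..3}}"
    unfolding permutations_3 st by (elim insertE emptyE) simp_all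
  then have perm: "perm3 a b c permutes {1..3}" by (rule CollectD)
  from abc show ?thesis
    by (rule disjE) (use that[OF perm] in simp_all)
qed

lemma free_operad_3_eqI:
  assumes "p \<in> operad_carrier free_operad 3" "q \<in> operad_carrier free_operad 3"
    and "\<And>s. s permutes {1..3} \<Longrightarrow> Poly_Mapping.lookup p (left_monomial (s 1) (s 2) (s 3))
      = Poly_Mapping.lookup q (left_monomial (s 1) (s 2) (s 3))"
    and "\<And>s. s permutes {1..3} \<Longrightarrow> Poly_Mapping.lookup p (right_monomial (s 1) (s 2) (s 3))
      = Poly_Mapping.lookup q (right_monomial (s 1) (s 2) (s 3))"
  shows "p = q"
proof (rule poly_mapping_eqI)
  fix t
  show "Poly_Mapping.lookup p t = Poly_Mapping.lookup q t"
  proof (cases "t \<in> multilinear_monomials 3")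
    case True
    then show ?thesis by (rule multilinear_monomials_3_cases) (use assms in auto)
  next
    case False
    then have "t \<notin> Poly_Mapping.keys p" "t \<notin> Poly_Mapping.keys q" using assms(1,2) by auto
    then show ?thesis by (simp add: in_keys_iff)
  qed
qed

lemma lookup_lin_inj: "inj f \<Longrightarrow> Poly_Mapping.lookup (lin f p) (f u) = Poly_Mapping.lookup p u"
  using subset_UNIV by (induction p rule: poly_mapping_induct)
    (auto simp: lookup_add lookup_single when_def inj_eq)

lemma inj_rename: "s permutes S \<Longrightarrow> inj (rename s)"
  by (rule inj_on_inverseI[of _ "rename (inv_into UNIV s)"])
    (simp add: rename_rename permutes_inv_o rename_id)

text \<open>Orthogonality to every renaming of the two dual relations, divided by the sign of the renaming;
  in this form the invariance under the symmetric group is immediate.\<close>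
definition pairing_equations :: "complex \<Rightarrow> tree_poly set" where
  "pairing_equations \<delta> = {r \<in> operad_carrier free_operad 3. \<forall>s. s permutes {1..3} \<longrightarrow>
     Poly_Mapping.lookup r (right_monomial (s 1) (s 2) (s 3))
       = Poly_Mapping.lookup r (right_monomial (s 2) (s 1) (s 3)) \<and>
     Poly_Mapping.lookup r (left_monomial (s 1) (s 2) (s 3))
       - Poly_Mapping.lookup r (left_monomial (s 1) (s 3) (s 2))
       = \<delta> * Poly_Mapping.lookup r (right_monomial (s 1) (s 2) (s 3))
       - \<delta> * Poly_Mapping.lookup r (right_monomial (s 1) (s 3) (s 2))}"

lemma free_operad_uminus:
  assumes "x \<in> operad_carrier free_operad n"
  shows "\<ominus>\<^bsub>arity_space free_operad n\<^esub> x = - x"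
proof -
  interpret module complex_ring "arity_space free_operad n" by (rule free_operad_module)
  show ?thesis using assms by (intro minus_equality) auto
qed

lemma sym_submodule_pairing_equations: "sym_submodule free_operad 3 (pairing_equations \<delta>)"
  unfolding sym_submodule_def
proof (intro conjI allI impI ballI)
  interpret module complex_ring "arity_space free_operad 3" by (rule free_operad_module)
  show "submodule (pairing_equations \<delta>) complex_ring (arity_space free_operad 3)"
  proof (rule submoduleI)
    fix a assume "a \<in> pairing_equations \<delta>"
    then show "\<ominus>\<^bsub>arity_space free_operad 3\<^esub> a \<in> pairing_equations \<delta>"
      by (subst free_operad_uminus) (auto simp: pairing_equations_def in_keys_iff algebra_simps)
  next
    fix c x assume "x \<in> pairing_equations \<delta>"
    then have x: "x \<in> operad_carrier free_operad 3"
      and "s permutes {1..3} \<Longrightarrow>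
        Poly_Mapping.lookup x (right_monomial (s 1) (s 2) (s 3))
          = Poly_Mapping.lookup x (right_monomial (s 2) (s 1) (s 3)) \<and>
        c * (Poly_Mapping.lookup x (left_monomial (s 1) (s 2) (s 3))
          - Poly_Mapping.lookup x (left_monomial (s 1) (s 3) (s 2)))
          = c * (\<delta> * Poly_Mapping.lookup x (right_monomial (s 1) (s 2) (s 3))
          - \<delta> * Poly_Mapping.lookup x (right_monomial (s 1) (s 3) (s 2)))" for s
      by (auto simp: pairing_equations_def)
    then show "c \<odot>\<^bsub>arity_space free_operad 3\<^esub> x \<in> pairing_equations \<delta>"
      by (auto simp: pairing_equations_def algebra_simps intro: subsetD[OF keys_scale_subset])
  next
    fix a b assume "a \<in> pairing_equations \<delta>" "b \<in> pairing_equations \<delta>"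
    then show "a \<oplus>\<^bsub>arity_space free_operad 3\<^esub> b \<in> pairing_equations \<delta>"
      using keys_add_subset[of a _ b]
      by (auto simp: pairing_equations_def lookup_add algebra_simps add_diff_eq)
  qed (auto simp: pairing_equations_def)
  fix t x assume t: "t permutes {1..3::nat}" and x: "x \<in> pairing_equations \<delta>"
  \<comment> \<open>A coefficient of the translate of \<open>x\<close> by \<open>t\<close> is the
    coefficient of \<open>x\<close> at the tree renamed by the inverse. So the equations for the
    translate at \<open>s\<close> are those for \<open>x\<close> at
    \<open>t' \<circ> s\<close>.\<close>
  define t' where "t' = inv_into UNIV t"
  have L: "Poly_Mapping.lookup (lin (rename t) x) (left_monomial a b c)
      = Poly_Mapping.lookup x (left_monomial (t' a) (t' b) (t' c))"
    and R: "Poly_Mapping.lookup (lin (rename t) x) (right_monomial a b c)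
      = Poly_Mapping.lookup x (right_monomial (t' a) (t' b) (t' c))" for a b c
    using lookup_lin_inj[OF inj_rename[OF t], of x "left_monomial (t' a) (t' b) (t' c)"]
      lookup_lin_inj[OF inj_rename[OF t], of x "right_monomial (t' a) (t' b) (t' c)"]
    by (simp_all add: t'_def permutes_inverses[OF t])
  have "t' \<circ> s permutes {1..3}" if "s permutes {1..3}" for s
    using that t unfolding t'_def by (intro permutes_compose permutes_inv)
  then show "sym_act free_operad 3 t x \<in> pairing_equations \<delta>"
    using x symmetric_operad.act_closed[OF free_operad_symmetric_operad t, of x]
    unfolding pairing_equations_def mem_Collect_eq
    by (simp add: L R) (metis comp_apply)
qed

lemma relations_carrier:
  "mock_novikov_rel1 \<delta> \<in> operad_carrier free_operad 3"
  "mock_novikov_rel2 \<in> operad_carrier free_operad 3"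
  "dual_rel1 \<in> operad_carrier free_operad 3"
  "dual_rel2 \<delta> \<in> operad_carrier free_operad 3"
proof -
  have single: "Poly_Mapping.single u c \<in> operad_carrier free_operad 3"
    if "u \<in> multilinear_monomials 3" for u and c :: complex using that by simp
  have add: "p + q \<in> operad_carrier free_operad 3"
    if "p \<in> operad_carrier free_operad 3" "q \<in> operad_carrier free_operad 3" for p q
    using that keys_add_subset by simp
  show "mock_novikov_rel1 \<delta> \<in> operad_carrier free_operad 3"
    unfolding mock_novikov_rel1_def
    by (intro add single) (auto simp: multilinear_monomials_def left_monomial_def right_monomial_def)
  show "mock_novikov_rel2 \<in> operad_carrier free_operad 3"
    unfolding mock_novikov_rel2_def
    by (intro add single) (auto simp: multilinear_monomials_def left_monomial_def right_monomial_def)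
  show "dual_rel1 \<in> operad_carrier free_operad 3"
    unfolding dual_rel1_def
    by (intro add single) (auto simp: multilinear_monomials_def left_monomial_def right_monomial_def)
  show "dual_rel2 \<delta> \<in> operad_carrier free_operad 3"
    unfolding dual_rel2_def
    by (intro add single) (auto simp: multilinear_monomials_def left_monomial_def right_monomial_def)
qed

text \<open>Testing the two generators suffices for all mock-Novikov relations, because
  \<open>pairing_equations\<close> is an invariant submodule.\<close>

lemma relations_pairing_equations:
  "{mock_novikov_rel1 \<delta>, mock_novikov_rel2} \<subseteq> pairing_equations \<delta>"
proof -
  have "mock_novikov_rel1 \<delta> \<in> pairing_equations \<delta>"
    unfolding pairing_equations_def
    by (intro CollectI conjI[OF relations_carrier(1)] allI impI, erule permutes_3_cases)
      (simp_all add: mock_novikov_rel1_def lookup_add lookup_single when_def)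
  moreover have "mock_novikov_rel2 \<in> pairing_equations \<delta>"
    unfolding pairing_equations_def
    by (intro CollectI conjI[OF relations_carrier(2)] allI impI, erule permutes_3_cases)
      (simp_all add: mock_novikov_rel2_def lookup_add lookup_single when_def)
  ultimately show ?thesis by simp
qed

text \<open>For the identity permutation, the defining equations of \<open>pairing_equations\<close>
  say, up to sign, that \<open>r\<close> pairs to zero with \<open>dual_rel1\<close> and with
  \<open>dual_rel2\<close>.\<close>

lemma dual_relations_annihilate:
  "{dual_rel1, dual_rel2 \<delta>} \<subseteq> gk_annihilator (mock_novikov_relations \<delta>)"
proof -
  have sub: "mock_novikov_relations \<delta> \<subseteq> pairing_equations \<delta>"
    unfolding mock_novikov_relations_def sym_submodule_gen_def
    using sym_submodule_pairing_equations relations_pairing_equations by blast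
  have "gk_pairing dual_rel1 r = 0 \<and> gk_pairing (dual_rel2 \<delta>) r = 0"
    if "r \<in> mock_novikov_relations \<delta>" for r
  proof -
    from that sub have "r \<in> pairing_equations \<delta>" by blast
    then have eq: "Poly_Mapping.lookup r (right_monomial 1 2 3)
        = Poly_Mapping.lookup r (right_monomial 2 1 3)"
      "Poly_Mapping.lookup r (left_monomial 1 2 3) - Poly_Mapping.lookup r (left_monomial 1 3 2)
        = \<delta> * Poly_Mapping.lookup r (right_monomial 1 2 3)
        - \<delta> * Poly_Mapping.lookup r (right_monomial 1 3 2)"
      unfolding pairing_equations_def using permutes_id[of "{1..3::nat}"] by (auto dest!: spec[of _ id])
    then show ?thesis
      unfolding gk_pairing_explicit dual_rel1_def dual_rel2_def
      by (simp add: lookup_add lookup_single when_def algebra_simps)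
  qed
  then show ?thesis
    using relations_carrier(3,4) unfolding gk_annihilator_def by blast
qed

lemma sym_submoduleD:
  assumes "sym_submodule free_operad n N"
  shows "\<lbrakk>s permutes {1..n}; x \<in> N\<rbrakk> \<Longrightarrow> lin (rename s) x \<in> N"
    and "x \<in> N \<Longrightarrow> scale c x \<in> N"
    and "\<lbrakk>x \<in> N; y \<in> N\<rbrakk> \<Longrightarrow> x + y \<in> N"
    and "N \<subseteq> operad_carrier free_operad n"
  using assms module.submoduleE[OF free_operad_module, of N n]
  by (auto simp: sym_submodule_def)

text \<open>\<open>pairing_equations\<close> is a member of the family being intersected, which is
  therefore nonempty.\<close>

lemma sym_submodule_mock_novikov_relations:
  "sym_submodule free_operad 3 (mock_novikov_relations \<delta>)"
  unfolding mock_novikov_relations_def sym_submodule_gen_def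
  using sym_submodule_pairing_equations relations_pairing_equations
  by (intro symmetric_operad.sym_submodule_Inter[OF free_operad_symmetric_operad]) auto

lemma mock_novikov_relations_gen:
  "{mock_novikov_rel1 \<delta>, mock_novikov_rel2} \<subseteq> mock_novikov_relations \<delta>"
  "\<lbrakk>sym_submodule free_operad 3 N; {mock_novikov_rel1 \<delta>, mock_novikov_rel2} \<subseteq> N\<rbrakk>
    \<Longrightarrow> mock_novikov_relations \<delta> \<subseteq> N"
  unfolding mock_novikov_relations_def sym_submodule_gen_def by blast+

text \<open>An element of the annihilator is determined by its three independent left coefficients and the
  three values of \<open>right - \<delta> * left\<close> on the classes under exchange of the first two inputs.\<close>
lemma annihilator_subset:
  assumes N: "sym_submodule free_operad 3 N" and d: "{dual_rel1, dual_rel2 \<delta>} \<subseteq> N"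
  shows "gk_annihilator (mock_novikov_relations \<delta>) \<subseteq> N"
proof
  fix f assume f: "f \<in> gk_annihilator (mock_novikov_relations \<delta>)"
  define L where "L a b c = Poly_Mapping.lookup f (left_monomial a b c)" for a b c
  define R where "R a b c = Poly_Mapping.lookup f (right_monomial a b c)" for a b c
  have pair: "gk_pairing f (lin (rename s) r) = 0"
    if "s permutes {1..3}" "r \<in> {mock_novikov_rel1 \<delta>, mock_novikov_rel2}" for s r
    using f sym_submoduleD(1)[OF sym_submodule_mock_novikov_relations that(1), of r]
      mock_novikov_relations_gen(1) that(2) unfolding gk_annihilator_def by blast
  \<comment> \<open>One renaming is taken for each pair of left combs that differ by an exchange of
    the last two inputs; for \<open>R\<close> below, one for each pair of right combs that differ in
    the first two.\<close>
  have L: "L 1 3 2 = L 1 2 3" "L 2 3 1 = L 2 1 3" "L 3 2 1 = L 3 1 2"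
    using pair[OF perm3_permutes(1), of mock_novikov_rel2]
      pair[OF perm3_permutes(2), of mock_novikov_rel2] pair[OF perm3_permutes(6), of mock_novikov_rel2]
    unfolding gk_pairing_explicit mock_novikov_rel2_def L_def
    by (simp_all add: lookup_add lookup_single when_def)
  have R: "R 2 1 3 - \<delta> * L 2 1 3 = R 1 2 3 - \<delta> * L 1 2 3"
    "R 3 1 2 - \<delta> * L 3 1 2 = R 1 3 2 - \<delta> * L 1 3 2"
    "R 3 2 1 - \<delta> * L 3 2 1 = R 2 3 1 - \<delta> * L 2 3 1"
    using pair[OF perm3_permutes(1), of "mock_novikov_rel1 \<delta>"]
      pair[OF perm3_permutes(3), of "mock_novikov_rel1 \<delta>"]
      pair[OF perm3_permutes(5), of "mock_novikov_rel1 \<delta>"]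
    unfolding gk_pairing_explicit mock_novikov_rel1_def L_def R_def
    by (simp_all add: lookup_add lookup_single when_def algebra_simps)
  \<comment> \<open>Left combs occur only in \<open>dual_rel2\<close>, so the left coefficients of
    \<open>f\<close> dictate its multiples. Those already contribute \<delta> times the left
    coefficient to each right comb, and \<open>dual_rel1\<close> supplies the remainder.\<close>
  define g where "g =
    scale (L 1 2 3) (lin (rename (perm3 1 2 3)) (dual_rel2 \<delta>)) +
    scale (L 2 1 3) (lin (rename (perm3 2 1 3)) (dual_rel2 \<delta>)) +
    scale (L 3 1 2) (lin (rename (perm3 3 1 2)) (dual_rel2 \<delta>)) +
    scale (R 1 2 3 - \<delta> * L 1 2 3) (lin (rename (perm3 1 2 3)) dual_rel1) +
    scale (R 1 3 2 - \<delta> * L 1 3 2) (lin (rename (perm3 1 3 2)) dual_rel1) +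
    scale (R 2 3 1 - \<delta> * L 2 3 1) (lin (rename (perm3 2 3 1)) dual_rel1)"
  have g: "g \<in> N"
    unfolding g_def using d by (intro sym_submoduleD(1-3)[OF N] perm3_permutes) auto
  have gl: "Poly_Mapping.lookup g (left_monomial (s 1) (s 2) (s 3)) = L (s 1) (s 2) (s 3)"
    if "s permutes {1..3}" for s
    using that
    by (rule permutes_3_cases)
      (use L in \<open>simp_all add: g_def dual_rel1_def dual_rel2_def lookup_add lookup_single when_def\<close>)
  have gr: "Poly_Mapping.lookup g (right_monomial (s 1) (s 2) (s 3)) = R (s 1) (s 2) (s 3)"
    if "s permutes {1..3}" for s
    using that
    by (rule permutes_3_cases)
      (use L R in \<open>simp_all add: g_def dual_rel1_def dual_rel2_def lookup_add lookup_single when_def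
        algebra_simps\<close>)
  have "f = g"
  proof (rule free_operad_3_eqI)
    show "f \<in> operad_carrier free_operad 3" using f by (simp add: gk_annihilator_def)
    show "g \<in> operad_carrier free_operad 3" using g sym_submoduleD(4)[OF N] by blast
  qed (simp_all only: gl gr, simp_all add: L_def R_def)
  with g show "f \<in> N" by simp
qed

section \<open>Mirroring exchanges the two ideals\<close>

lemma flip_hom: "operad_hom free_operad free_operad (\<lambda>n. lin flip)"
  unfolding operad_hom_def
proof (intro conjI allI ballI impI, goal_cases)
  case (1 n x)
  then show ?case by (simp add: keys_lin_subset[OF _ flip_multilinear])
next
  case (4 n s x)
  have "flip \<circ> rename s = rename s \<circ> flip" by (auto simp: flip_rename)
  then show ?case by (simp add: lin_comp)
next
  case (6 m n i x y)
  show ?case unfolding free_operad_simps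
    by (rule lin_bilin[OF subset_UNIV subset_UNIV]) (rule flip_graft)
qed (simp_all add: lin_scale)

lemma lin_flip_flip: "lin flip (lin flip p) = p"
  unfolding lin_comp by (rule lin_ident[OF subset_UNIV]) (simp add: flip_flip)

lemma flip_bij: "bij_betw (lin flip) (operad_carrier free_operad n) (operad_carrier free_operad n)"
  by (rule bij_betw_byWitness[where f' = "lin flip"])
    (auto simp: lin_flip_flip intro: subsetD[OF keys_lin_subset[OF _ flip_multilinear]])

text \<open>Mirroring turns (ab)c into c(ba): besides changing the shape of a comb it reverses the
  reading order of its labels. Exchanging 1 and 3 compensates for this reversal.\<close>

lemma flip_relations:
  "lin flip dual_rel1 = lin (rename (perm3 3 2 1)) mock_novikov_rel2"
  "lin flip (dual_rel2 \<delta>) = lin (rename (perm3 3 2 1)) (mock_novikov_rel1 \<delta>)"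
  "lin flip mock_novikov_rel2 = lin (rename (perm3 3 2 1)) dual_rel1"
  "lin flip (mock_novikov_rel1 \<delta>) = lin (rename (perm3 3 2 1)) (dual_rel2 \<delta>)"
  by (simp_all add: dual_rel1_def dual_rel2_def mock_novikov_rel1_def mock_novikov_rel2_def ac_simps)

text \<open>The ideal of \<open>H\<close> is pulled back along mirroring. An ideal is closed under
  renaming, so a mirrored generator need only agree with an element of \<open>H\<close> up to a
  renaming.\<close>

lemma flip_ideal_gen:
  assumes "\<And>x. x \<in> G \<Longrightarrow> \<exists>s y. s permutes {1..k} \<and> y \<in> H \<and> lin flip x = lin (rename s) y"
    and G: "G \<subseteq> operad_carrier free_operad k" and H: "H \<subseteq> operad_carrier free_operad k"
  shows "lin flip ` operad_ideal_gen free_operad k G n \<subseteq> operad_ideal_gen free_operad k H n"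
proof -
  interpret symmetric_operad free_operad by (rule free_operad_symmetric_operad)
  let ?I = "operad_ideal_gen free_operad k H"
  have I: "operad_ideal free_operad ?I" by (rule operad_ideal_gen_ideal[OF H])
  have "operad_ideal free_operad (\<lambda>n. {x \<in> operad_carrier free_operad n. lin flip x \<in> ?I n})"
    by (rule operad_ideal_preimage[OF symmetric_operad_axioms symmetric_operad_axioms flip_hom I])
  moreover have "lin flip x \<in> ?I k" if "x \<in> G" for x
    using assms(1)[OF that] operad_idealD(2)[OF I, of _ k] operad_ideal_gen_incl[of H free_operad k]
    by auto
  ultimately have "operad_ideal_gen free_operad k G n
      \<subseteq> {x \<in> operad_carrier free_operad n. lin flip x \<in> ?I n}"
    using G by (intro operad_ideal_gen_least) auto
  then show ?thesis by blast
qed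

text \<open>The arity 3 part of an ideal is an invariant submodule, so ideals cannot tell apart two
  sets contained in the same invariant submodules. This lets two relations stand in for the
  submodule they generate.\<close>

lemma quadratic_operad_cong:
  assumes "\<And>N. sym_submodule free_operad 3 N \<Longrightarrow> R \<subseteq> N \<longleftrightarrow> R' \<subseteq> N"
  shows "quadratic_operad R = quadratic_operad R'"
proof -
  have "operad_ideal_gen free_operad 3 R n = operad_ideal_gen free_operad 3 R' n" for n
    unfolding operad_ideal_gen_def using assms by (metis operad_ideal_def)
  then have "operad_ideal_gen free_operad 3 R = operad_ideal_gen free_operad 3 R'" ..
  then show ?thesis by (simp add: quadratic_operad_def)
qed

theorem theorem3p2:
  fixes \<delta> :: complex
  assumes "\<delta> \<noteq> 0"
  shows "mock_novikov_dual \<delta> = quadratic_operad {dual_rel1, dual_rel2 \<delta>} \<and>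
    operads_isomorphic (mock_novikov_dual \<delta>) (mock_novikov_operad \<delta>)"
proof -
  interpret symmetric_operad free_operad by (rule free_operad_symmetric_operad)
  let ?D = "{dual_rel1, dual_rel2 \<delta>}" and ?M = "{mock_novikov_rel1 \<delta>, mock_novikov_rel2}"
  have dual: "mock_novikov_dual \<delta> = quadratic_operad ?D"
    unfolding mock_novikov_dual_def
    using annihilator_subset dual_relations_annihilate
    by (intro quadratic_operad_cong iffI) (metis order_trans)+
  have mock: "mock_novikov_operad \<delta> = quadratic_operad ?M"
    unfolding mock_novikov_operad_def
    using mock_novikov_relations_gen by (intro quadratic_operad_cong iffI) (metis order_trans)+
  have carr: "?D \<subseteq> operad_carrier free_operad 3" "?M \<subseteq> operad_carrier free_operad 3"
    using relations_carrier by auto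
  let ?J = "operad_ideal_gen free_operad 3 ?D" and ?I = "operad_ideal_gen free_operad 3 ?M"
  have "lin flip ` ?J n = ?I n" for n
  proof
    show JI: "lin flip ` ?J n \<subseteq> ?I n"
      using flip_relations(1,2) perm3_permutes(4)
      by (intro flip_ideal_gen[OF _ carr]) blast
    \<comment> \<open>Mirroring is an involution: the inclusion with the ideals exchanged, mirrored
      once more, is the missing one.\<close>
    have "lin flip ` ?I n \<subseteq> ?J n"
      using flip_relations(3,4) perm3_permutes(4)
      by (intro flip_ideal_gen[OF _ carr(2,1)]) blast
    then have "lin flip ` lin flip ` ?I n \<subseteq> lin flip ` ?J n" by (rule image_mono)
    then show "?I n \<subseteq> lin flip ` ?J n" by (simp add: image_image lin_flip_flip)
  qed
  then have "operads_isomorphic (quadratic_operad ?D) (quadratic_operad ?M)"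
    unfolding quadratic_operad_def
    by (intro quotient_operads_isomorphic[OF symmetric_operad_axioms symmetric_operad_axioms flip_hom
        flip_bij operad_ideal_gen_ideal[OF carr(1)] operad_ideal_gen_ideal[OF carr(2)]])
  with dual mock show ?thesis by simp
qed

end
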